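(* Let $Q:\mathbb{T}^n\to[0,+\infty)$ be real analytic with nonempty zero set $\mathscr{Z}=\{\Phi\in\mathbb{T}^n:Q(\Phi)=0\}$, and let $\Phi_0\in\mathbb{T}^n$. Then there exists $\Phi\in\mathscr{A}$ which is a global minimizer over $\mathscr{A}$ of $$K(\Phi)=\int_0^\infty\tfrac12\|\dot\Phi\|^2+Q(\Phi)\,dt .$$
   Context: $\mathbb{T}=\mathbb{R}/2\pi\mathbb{Z}$. $H^1_{loc}([0,+\infty);\mathbb{T}^n)$ is the set of maps $\Phi:[0,+\infty)\to\mathbb{T}^n$ belonging to $H^1((0,T);\mathbb{T}^n)$ for every $T>0$ (continuous, weakly differentiable with $\dot\Phi\in L^2((0,T);\mathbb{R}^n)$). The set of admissible trajectories is $$\mathscr{A}=\left\{\Phi\in H^1_{loc}([0,+\infty);\mathbb{T}^n)\ :\ \Phi(0)=\Phi_0,\ \tfrac12\|\dot\Phi\|^2+Q(\Phi)\in L^1(0,+\infty)\right\}.$$ *)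

theory Defs
  imports "HOL-Analysis.Analysis"
begin

section \<open>The torus\<close>

definition cong_2pi :: "real \<Rightarrow> real \<Rightarrow> bool" where
  "cong_2pi x y \<longleftrightarrow> (\<exists>k::int. x - y = 2 * pi * of_int k)"

lemma equivp_cong_2pi: "equivp cong_2pi"
proof (rule equivpI)
  show "reflp cong_2pi"
    by (rule reflpI) (auto simp: cong_2pi_def intro: exI[of _ 0])
  show "symp cong_2pi"
  proof (rule sympI)
    fix x y assume "cong_2pi x y"
    then obtain k :: int where "x - y = 2 * pi * of_int k"
      by (auto simp: cong_2pi_def)
    then have "y - x = 2 * pi * of_int (- k)" by simp
    then show "cong_2pi y x" unfolding cong_2pi_def by blast
  qed
  show "transp cong_2pi"
  proof (rule transpI)
    fix x y z assume "cong_2pi x y" "cong_2pi y z"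
    then obtain k l :: int where "x - y = 2 * pi * of_int k" "y - z = 2 * pi * of_int l"
      by (auto simp: cong_2pi_def)
    then have "x - z = 2 * pi * of_int (k + l)" by (simp add: algebra_simps)
    then show "cong_2pi x z" unfolding cong_2pi_def by blast
  qed
qed

quotient_type circ = real / cong_2pi
  morphisms rep_circ to_circ
  by (rule equivp_cong_2pi)

instantiation circ :: topological_space
begin

definition open_circ :: "circ set \<Rightarrow> bool" where
  "open_circ U \<longleftrightarrow> open (to_circ -` U)"

instance
  by standard (auto simp: open_circ_def vimage_Union)

end

type_synonym 'n torus = "circ ^ 'n"

definition to_torus :: "real ^ 'n \<Rightarrow> 'n::finite torus" where
  "to_torus x = (\<chi> i. to_circ (x $ i))"

section \<open>Real analyticity\<close>

text \<open>Locally the sum of an unconditionally convergent multivariate power series;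
  a multi-index is a function \<open>'n \<Rightarrow> nat\<close>.\<close>

definition real_analytic :: "(real ^ 'n \<Rightarrow> real) \<Rightarrow> bool" where
  "real_analytic f \<longleftrightarrow> (\<forall>a. \<exists>r>0. \<exists>c :: ('n \<Rightarrow> nat) \<Rightarrow> real. \<forall>x. (\<forall>i. \<bar>x $ i - a $ i\<bar> < r) \<longrightarrow>
     ((\<lambda>\<alpha>. c \<alpha> * (\<Prod>i\<in>UNIV. (x $ i - a $ i) ^ \<alpha> i)) has_sum f x) UNIV)"

text \<open>The local inverses of \<^term>\<open>to_torus\<close> are the charts of the torus.\<close>

definition torus_real_analytic :: "('n::finite torus \<Rightarrow> real) \<Rightarrow> bool" where
  "torus_real_analytic Q \<longleftrightarrow> real_analytic (\<lambda>x. Q (to_torus x))"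

section \<open>Weak derivatives and Sobolev maps\<close>

text \<open>Functions on an interval are total functions whose values off the interval are ignored.\<close>

definition test_function :: "real set \<Rightarrow> (real \<Rightarrow> real) \<Rightarrow> bool" where
  "test_function I \<psi> \<longleftrightarrow>
     (\<forall>t. \<psi> differentiable (at t)) \<and> continuous_on UNIV (deriv \<psi>) \<and>
     (\<exists>C. compact C \<and> C \<subseteq> I \<and> (\<forall>t. t \<notin> C \<longrightarrow> \<psi> t = 0))"

definition locally_integrable :: "real set \<Rightarrow> (real \<Rightarrow> real ^ 'n) \<Rightarrow> bool" where
  "locally_integrable I f \<longleftrightarrow> (\<forall>C. compact C \<and> C \<subseteq> I \<longrightarrow> set_integrable lborel C f)"

text \<open>Weak derivative on an open interval \<open>I\<close>, with test functions in \<open>C\<^sub>c\<^sup>1(I)\<close> as in Brezis.\<close>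

definition has_weak_deriv ::
    "(real \<Rightarrow> real ^ 'n) \<Rightarrow> (real \<Rightarrow> real ^ 'n) \<Rightarrow> real set \<Rightarrow> bool" where
  "has_weak_deriv f g I \<longleftrightarrow> locally_integrable I f \<and> locally_integrable I g \<and>
     (\<forall>\<psi>. test_function I \<psi> \<longrightarrow>
        (LINT t:I|lborel. deriv \<psi> t *\<^sub>R f t) = - (LINT t:I|lborel. \<psi> t *\<^sub>R g t))"

text \<open>Two continuous lifts of the same map on an interval differ by a constant, so the weak
  derivative of a torus-valued map does not depend on the lift.\<close>

definition torus_weak_deriv ::
    "(real \<Rightarrow> 'n::finite torus) \<Rightarrow> (real \<Rightarrow> real ^ 'n) \<Rightarrow> real set \<Rightarrow> bool" where
  "torus_weak_deriv \<Phi> v I \<longleftrightarrow>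
     (\<exists>\<phi>. continuous_on I \<phi> \<and> (\<forall>t\<in>I. \<Phi> t = to_torus (\<phi> t)) \<and> has_weak_deriv \<phi> v I)"

definition L2 :: "real set \<Rightarrow> (real \<Rightarrow> real ^ 'n) set" where
  "L2 I = {v. set_borel_measurable lborel I v \<and> set_integrable lborel I (\<lambda>t. (norm (v t))\<^sup>2)}"

text \<open>The condition \<open>\<Phi> \<in> L\<^sup>2\<close> is automatic: the torus is bounded. Members are represented by
  their continuous representative on the closed interval.\<close>

definition H1 :: "real \<Rightarrow> (real \<Rightarrow> 'n::finite torus) set" where
  "H1 T = {\<Phi>. continuous_on {0..T} \<Phi> \<and> (\<exists>v\<in>L2 {0<..<T}. torus_weak_deriv \<Phi> v {0<..<T})}"

definition H1_loc :: "(real \<Rightarrow> 'n::finite torus) set" where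
  "H1_loc = {\<Phi>. \<forall>T>0. \<Phi> \<in> H1 T}"

text \<open>Determined up to a null set for \<open>\<Phi>\<close> in \<^term>\<open>H1_loc\<close>.\<close>

definition velocity :: "(real \<Rightarrow> 'n::finite torus) \<Rightarrow> real \<Rightarrow> real ^ 'n" where
  "velocity \<Phi> = (SOME v. torus_weak_deriv \<Phi> v {0<..})"

section \<open>The variational problem\<close>

definition zero_set :: "('n::finite torus \<Rightarrow> real) \<Rightarrow> 'n torus set" where
  "zero_set Q = {\<Phi>. Q \<Phi> = 0}"

definition lagrangian :: "('n::finite torus \<Rightarrow> real) \<Rightarrow> (real \<Rightarrow> 'n torus) \<Rightarrow> real \<Rightarrow> real" where
  "lagrangian Q \<Phi> t = 1/2 * (norm (velocity \<Phi> t))\<^sup>2 + Q (\<Phi> t)"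

definition admissible :: "('n::finite torus \<Rightarrow> real) \<Rightarrow> 'n torus \<Rightarrow> (real \<Rightarrow> 'n torus) set" where
  "admissible Q \<Phi>\<^sub>0 =
     {\<Phi> \<in> H1_loc. \<Phi> 0 = \<Phi>\<^sub>0 \<and> set_integrable lborel {0<..} (lagrangian Q \<Phi>)}"

definition action :: "('n::finite torus \<Rightarrow> real) \<Rightarrow> (real \<Rightarrow> 'n torus) \<Rightarrow> real" where
  "action Q \<Phi> = (LINT t:{0<..}|lborel. lagrangian Q \<Phi> t)"

end

theory Submission
  imports Defs "HOL-Complex_Analysis.Great_Picard"
begin

text \<open>By du Bois-Reymond and Fubini, \<open>v\<close> is a weak derivative of a continuous \<open>\<phi>\<close> iff
  \<open>\<phi> b - \<phi> a = \<integral>\<^sub>a\<^sup>b v\<close> for all \<open>a \<le> b\<close>. Since lifts of a map into the torus differ by constants, the admissible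
  trajectories are exactly the maps \<open>t \<mapsto> to_torus (x + \<integral>\<^sub>0\<^sup>t u)\<close> with \<open>u\<close> square integrable and finite
  potential energy, and the problem becomes the direct method for \<open>u\<close> in \<open>L\<^sup>2\<close>: along a minimizing sequence
  the lifted paths are equi-Hoelder of exponent \<open>1/2\<close>, so a subsequence converges pointwise, and the limit path
  has a velocity whose norm is at most the limit of the norms. Fatou's lemma bounds the potential energy.
  A straight segment that stops at a zero of \<open>Q\<close> shows that admissible trajectories exist.\<close>

section \<open>Weak derivatives as integrands\<close>

text \<open>The action refers to \<open>velocity\<close>, an arbitrary choice among the weak
  derivatives on the whole half-line, while \<open>H1_loc\<close> supplies a derivative and a lift
  for each bounded interval separately. So local data have to be glued, and any two integrands have
  to agree almost everywhere, before the action can be computed from a concrete u.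
  \<open>primitive_on\<close> asks for integrability and the integral identity between points of I
  only, hence for nothing up to the ends of an open I. Fixing one lift x of
  \<open>\<Phi>\<^sub>0\<close> puts all competitors into one vector space with a common starting
  point. Kinetic and potential energy are semicontinuous for different reasons, the first by
  convexity, the second by pointwise convergence. To add the two bounds, a subsequence is chosen
  along which the integrals of the squared speed converge to some A; the potential integrals then
  converge to m - A/2, where m is the infimum, and the two halves recombine to exactly m.\<close>

definition primitive_on :: "(real \<Rightarrow> real ^ 'n) \<Rightarrow> (real \<Rightarrow> real ^ 'n) \<Rightarrow> real set \<Rightarrow> bool" where
  "primitive_on \<phi> v I \<longleftrightarrow> (\<forall>a\<in>I. \<forall>b\<in>I. a \<le> b \<longrightarrow>
     set_integrable lborel {a..b} v \<and> \<phi> b - \<phi> a = (LINT t:{a..b}|lborel. v t))"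

lemma primitive_onD:
  assumes "primitive_on \<phi> v I" "a \<in> I" "b \<in> I" "a \<le> b"
  shows "set_integrable lborel {a..b} v" "\<phi> b - \<phi> a = (LINT t:{a..b}|lborel. v t)"
  using assms by (auto simp: primitive_on_def)

lemma primitive_on_subset: "primitive_on \<phi> v I \<Longrightarrow> J \<subseteq> I \<Longrightarrow> primitive_on \<phi> v J"
  unfolding primitive_on_def by blast

text \<open>Adjoining x to C makes the set nonempty, so its minimum and maximum exist and can be
  pushed slightly outward inside the open I. With empty C this yields a compact neighbourhood of
  x.\<close>

lemma compact_in_interval_bounds:
  fixes I C :: "real set"
  assumes "open I" "is_interval I" "compact C" "C \<subseteq> I" "x \<in> I"
  obtains a b where "a \<in> I" "b \<in> I" "a < x" "x < b" "C \<subseteq> {a<..<b}" "{a..b} \<subseteq> I"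
proof -
  let ?D = "insert x C"
  have D: "compact ?D" "?D \<noteq> {}" "?D \<subseteq> I" using assms by auto
  obtain s where s: "s \<in> ?D" "\<And>t. t \<in> ?D \<Longrightarrow> s \<le> t" using compact_attains_inf[OF D(1,2)] by auto
  obtain u where u: "u \<in> ?D" "\<And>t. t \<in> ?D \<Longrightarrow> t \<le> u" using compact_attains_sup[OF D(1,2)] by auto
  obtain e where e: "e > 0" "ball s e \<subseteq> I" using D(3) s(1) \<open>open I\<close> by (meson open_contains_ball subsetD)
  obtain d where d: "d > 0" "ball u d \<subseteq> I" using D(3) u(1) \<open>open I\<close> by (meson open_contains_ball subsetD)
  have 1: "s - e/2 \<in> I" using e by (auto simp: subset_iff dist_real_def)
  have 2: "u + d/2 \<in> I" using d by (auto simp: subset_iff dist_real_def)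
  have 3: "{s - e/2..u + d/2} \<subseteq> I" using 1 2 \<open>is_interval I\<close> unfolding is_interval_1 by (meson atLeastAtMost_iff subsetI)
  have lt: "s - e/2 < t \<and> t < u + d/2" if "t \<in> ?D" for t using s(2)[OF that] u(2)[OF that] e d by linarith
  have 4: "s - e/2 < x" "x < u + d/2" using lt[of x] by auto
  have 5: "C \<subseteq> {s - e/2<..<u + d/2}" using lt by force
  show ?thesis by (rule that[OF 1 2 4 5 3])
qed

lemma locally_integrable_iff:
  assumes "open I" "is_interval I"
  shows "locally_integrable I v \<longleftrightarrow> (\<forall>a\<in>I. \<forall>b\<in>I. set_integrable lborel {a..b} v)"
proof safe
  fix a b assume *: "locally_integrable I v" "a \<in> I" "b \<in> I"
  have "{a..b} \<subseteq> I" using * assms(2) unfolding is_interval_1 by (meson atLeastAtMost_iff subsetI)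
  then show "set_integrable lborel {a..b} v" using * unfolding locally_integrable_def by simp
next
  assume *: "\<forall>a\<in>I. \<forall>b\<in>I. set_integrable lborel {a..b} v"
  show "locally_integrable I v" unfolding locally_integrable_def
  proof safe
    fix C assume C: "compact C" "C \<subseteq> I"
    show "set_integrable lborel C v"
    proof (cases "C = {}")
      case False
      then obtain x where "x \<in> I" using C by auto
      from compact_in_interval_bounds[OF assms C this] obtain a b
        where "a \<in> I" "b \<in> I" "C \<subseteq> {a<..<b}" by metis
      then show ?thesis using * C by (intro set_integrable_subset[of lborel "{a..b}" v C])
        (force simp: borel_closed compact_imp_closed)+
    qed simp
  qed
qed

lemma primitive_on_locally_integrable:
  assumes "open I" "is_interval I" "primitive_on \<phi> v I"
  shows "locally_integrable I v"
  unfolding locally_integrable_iff[OF assms(1,2)]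
proof safe
  fix a b assume "a \<in> I" "b \<in> I"
  then show "set_integrable lborel {a..b} v"
    using primitive_onD(1)[OF assms(3)] by (cases "a \<le> b") auto
qed

lemma primitive_on_continuous_Icc:
  assumes "primitive_on \<phi> v {a..b}"
  shows "continuous_on {a..b} \<phi>"
proof (cases "a \<le> b")
  case True
  have si: "set_integrable lborel {a..b} v" using assms True by (auto simp: primitive_on_def)
  have "\<phi> t = \<phi> a + integral {a..t} v" if "t \<in> {a..b}" for t
  proof -
    have "set_integrable lborel {a..t} v" "\<phi> t - \<phi> a = (LINT t:{a..t}|lborel. v t)"
      using assms that by (auto simp: primitive_on_def)
    then show ?thesis using set_borel_integral_eq_integral(2) by (metis add.commute diff_add_cancel)
  qed
  moreover have "continuous_on {a..b} (\<lambda>t. \<phi> a + integral {a..t} v)"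
    by (intro continuous_intros indefinite_integral_continuous_1 set_borel_integral_eq_integral(1)[OF si])
  ultimately show ?thesis by (metis (no_types, lifting) continuous_on_cong)
qed simp

lemma primitive_on_continuous:
  assumes "open I" "is_interval I" "primitive_on \<phi> v I"
  shows "continuous_on I \<phi>"
proof (rule continuous_at_imp_continuous_on, rule ballI)
  fix x assume x: "x \<in> I"
  obtain a b where ab: "a < x" "x < b" "{a..b} \<subseteq> I"
    using compact_in_interval_bounds[OF assms(1,2) compact_empty empty_subsetI x] by metis
  have "continuous_on {a..b} \<phi>"
    using primitive_on_continuous_Icc primitive_on_subset[OF assms(3) ab(3)] by blast
  then show "isCont \<phi> x" using ab by (intro continuous_on_interior[of "{a..b}"]) (auto simp: interior_atLeastAtMost_real)
qed

section \<open>Integration by parts for primitives\<close>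

text \<open>Fubini on the triangle s \<le> t inside the square over \<open>{a..b}\<close>:
  integrating the product of \<open>g t\<close> and \<open>v s\<close> first in s gives
  \<open>g t *\<^sub>R (\<phi> t - \<phi> a)\<close>, first in t it gives
  \<open>- (\<psi> s *\<^sub>R v s)\<close>. Only \<psi> is differentiated, so \<phi> may be the
  primitive of a merely integrable function.\<close>

lemma integral_by_parts_primitive:
  fixes v :: "real \<Rightarrow> real ^ 'n"
  assumes P: "primitive_on \<phi> v {a..b}" and ab: "a \<le> b"
    and d: "\<And>t. (\<psi> has_real_derivative g t) (at t)" and g: "continuous_on UNIV g"
    and z: "\<psi> a = 0" "\<psi> b = 0"
  shows "(LINT t:{a..b}|lborel. g t *\<^sub>R \<phi> t) = - (LINT t:{a..b}|lborel. \<psi> t *\<^sub>R v t)"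
proof -
  define u where "u s = indicator {a..b} s *\<^sub>R v s" for s
  define h where "h t = indicator {a..b} t * g t" for t
  have iu: "integrable lborel u" using P ab by (auto simp: primitive_on_def set_integrable_def u_def[abs_def])
  have ih: "integrable lborel h"
    using borel_integrable_compact[of "{a..b}" g] g continuous_on_subset
    by (auto simp: h_def[abs_def])
  have [measurable]: "u \<in> borel_measurable borel" "h \<in> borel_measurable borel" using iu ih by auto
  define f where "f t s = (if s \<le> t then h t *\<^sub>R u s else 0)" for t s
  have FTC: "(\<integral>t. indicator {s..b} t * g t \<partial>lborel) = \<psi> b - \<psi> s" if "s \<le> b" for s
    using integral_FTC_Icc_real[of s b \<psi> g] that d g
    by (simp add: mult.commute has_field_derivative_at_within continuous_on_eq_continuous_at)
  have int0: "integrable (lborel \<Otimes>\<^sub>M lborel) (\<lambda>(t,s). h t *\<^sub>R u s)"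
  proof (rule lborel_pair.Fubini_integrable)
    show "integrable lborel (\<lambda>x. LINT y|lborel. norm (case (x, y) of (t, s) \<Rightarrow> h t *\<^sub>R u s))"
      using ih iu by simp
    show "AE x in lborel. integrable lborel (\<lambda>y. case (x, y) of (t, s) \<Rightarrow> h t *\<^sub>R u s)"
      using iu by simp
  qed measurable
  have intf: "integrable (lborel \<Otimes>\<^sub>M lborel) (case_prod f)"
  proof (rule Bochner_Integration.integrable_bound[OF int0])
    show "case_prod f \<in> borel_measurable (lborel \<Otimes>\<^sub>M lborel)"
      unfolding f_def case_prod_beta' by measurable
  qed (auto simp: f_def)
  have inner1: "(\<integral>s. f t s \<partial>lborel) = h t *\<^sub>R (\<phi> t - \<phi> a)" for t
  proof (cases "t \<in> {a..b}")
    case True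
    have "(\<integral>s. f t s \<partial>lborel) = (\<integral>s. h t *\<^sub>R (indicator {a..t} s *\<^sub>R v s) \<partial>lborel)"
      using True by (intro Bochner_Integration.integral_cong) (auto simp: f_def u_def indicator_def)
    also have "\<dots> = h t *\<^sub>R (LINT s:{a..t}|lborel. v s)" 
      unfolding set_lebesgue_integral_def by (rule integral_scaleR_right)
    finally show ?thesis using P True by (auto simp: primitive_on_def)
  next
    case False
    then have "f t s = 0" for s by (auto simp: f_def h_def)
    then show ?thesis using False by (simp add: h_def)
  qed
  have inner2: "(\<integral>t. f t s \<partial>lborel) = - (\<psi> s *\<^sub>R u s)" for s
  proof (cases "s \<in> {a..b}")
    case True
    have "(\<integral>t. f t s \<partial>lborel) = (\<integral>t. (indicator {s..b} t * g t) *\<^sub>R u s \<partial>lborel)"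
      using True by (intro Bochner_Integration.integral_cong) (auto simp: f_def h_def indicator_def)
    also have "\<dots> = (\<integral>t. (indicator {s..b} t * g t) \<partial>lborel) *\<^sub>R u s"
      using borel_integrable_compact[of "{s..b}" g] g continuous_on_subset
      by (intro integral_scaleR_left) auto
    finally show ?thesis using FTC[of s] True z by simp
  next
    case False
    then have "f t s = 0" for t by (auto simp: f_def u_def)
    then show ?thesis using False by (simp add: u_def)
  qed
  have c: "continuous_on {a..b} \<phi>" by (rule primitive_on_continuous_Icc[OF P])
  have ihp: "integrable lborel (\<lambda>t. h t *\<^sub>R \<phi> t)"
    using borel_integrable_compact[of "{a..b}" "\<lambda>t. g t *\<^sub>R \<phi> t"] c continuous_on_subset[OF g]
    by (auto simp: h_def[abs_def] intro!: continuous_intros)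
  \<comment> \<open>The triangle integral produces \<phi> minus its value at a; the constant
    contributes a multiple of the integral of g, which is
    \<open>\<psi> b - \<psi> a = 0\<close>.\<close>
  have "(\<integral>t. h t *\<^sub>R \<phi> t \<partial>lborel) = (\<integral>t. h t *\<^sub>R (\<phi> t - \<phi> a) + h t *\<^sub>R \<phi> a \<partial>lborel)"
    by (simp add: algebra_simps)
  also have "\<dots> = (\<integral>t. h t *\<^sub>R (\<phi> t - \<phi> a) \<partial>lborel) + (\<integral>t. h t *\<^sub>R \<phi> a \<partial>lborel)"
    using ih ihp by (intro Bochner_Integration.integral_add) (auto simp: scaleR_diff_right)
  also have "(\<integral>t. h t *\<^sub>R \<phi> a \<partial>lborel) = (\<integral>t. h t \<partial>lborel) *\<^sub>R \<phi> a"
    using ih by simp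
  also have "(\<integral>t. h t \<partial>lborel) = 0" using FTC[OF ab] z by (simp add: h_def)
  also have "(\<integral>t. h t *\<^sub>R (\<phi> t - \<phi> a) \<partial>lborel) = (\<integral>t. (\<integral>s. f t s \<partial>lborel) \<partial>lborel)" by (simp add: inner1)
  also have "\<dots> = (\<integral>s. (\<integral>t. f t s \<partial>lborel) \<partial>lborel)"
    using lborel_pair.Fubini_integral[OF intf] by simp
  also have "\<dots> = - (\<integral>s. \<psi> s *\<^sub>R u s \<partial>lborel)" by (simp add: inner2)
  finally show ?thesis by (simp add: set_lebesgue_integral_def h_def u_def mult.commute)
qed

lemma test_function_deriv:
  assumes "test_function I \<psi>"
  obtains C where "compact C" "C \<subseteq> I" "\<And>t. t \<notin> C \<Longrightarrow> \<psi> t = 0" "\<And>t. t \<notin> C \<Longrightarrow> deriv \<psi> t = 0"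
    "\<And>t. (\<psi> has_real_derivative deriv \<psi> t) (at t)"
proof -
  obtain C where \<psi>: "\<And>t. \<psi> differentiable (at t)"
    and C: "compact C" "C \<subseteq> I" "\<And>t. t \<notin> C \<Longrightarrow> \<psi> t = 0"
    using assms by (auto simp: test_function_def)
  have "deriv \<psi> t = 0" if "t \<notin> C" for t
  proof -
    have "eventually (\<lambda>x. \<psi> x = 0) (nhds t)"
      using C that by (intro eventually_nhds[THEN iffD2] exI[of _ "- C"]) (auto intro: compact_imp_closed)
    then have "deriv \<psi> t = deriv (\<lambda>_. 0) t" by (intro deriv_cong_ev) auto
    then show ?thesis by simp
  qed
  moreover have "(\<psi> has_real_derivative deriv \<psi> t) (at t)" for t
    using \<psi>[of t] by (simp add: DERIV_deriv_iff_real_differentiable)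
  ultimately show ?thesis using that[OF C] by metis
qed

lemma primitive_on_weak_deriv:
  assumes I: "open I" "is_interval I" and P: "primitive_on \<phi> v I"
  shows "has_weak_deriv \<phi> v I"
  unfolding has_weak_deriv_def
proof (intro conjI allI impI)
  show "locally_integrable I v" by (rule primitive_on_locally_integrable[OF I P])
  have c: "continuous_on I \<phi>" by (rule primitive_on_continuous[OF I P])
  then show "locally_integrable I \<phi>"
    unfolding locally_integrable_def set_integrable_def
    by (metis borel_integrable_compact continuous_on_subset)
  fix \<psi> assume "test_function I \<psi>"
  from test_function_deriv[OF this] obtain C where C: "compact C" "C \<subseteq> I" "\<And>t. t \<notin> C \<Longrightarrow> \<psi> t = 0"
    and d0: "\<And>t. t \<notin> C \<Longrightarrow> deriv \<psi> t = 0" and d: "\<And>t. (\<psi> has_real_derivative deriv \<psi> t) (at t)" by metis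
  have c\<psi>: "continuous_on UNIV (deriv \<psi>)" using \<open>test_function I \<psi>\<close> by (simp add: test_function_def)
  show "(LINT t:I|lborel. deriv \<psi> t *\<^sub>R \<phi> t) = - (LINT t:I|lborel. \<psi> t *\<^sub>R v t)"
  proof (cases "I = {}")
    case False
    then obtain x where "x \<in> I" by auto
    from compact_in_interval_bounds[OF I C(1,2) this] obtain a b
      where ab: "a < x" "x < b" "C \<subseteq> {a<..<b}" "{a..b} \<subseteq> I" by metis
    \<comment> \<open>C lies strictly inside, so \<psi> vanishes at both ends, as the integration by
      parts requires.\<close>
    have na: "a \<notin> C" "b \<notin> C" using ab by auto
    have "(LINT t:I|lborel. deriv \<psi> t *\<^sub>R \<phi> t) = (LINT t:{a..b}|lborel. deriv \<psi> t *\<^sub>R \<phi> t)"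
      unfolding set_lebesgue_integral_def
      using ab d0 by (intro Bochner_Integration.integral_cong) (force simp: indicator_def)+
    also have "\<dots> = - (LINT t:{a..b}|lborel. \<psi> t *\<^sub>R v t)"
      using ab(1,2,4) C(3)[OF na(1)] C(3)[OF na(2)]
      by (intro integral_by_parts_primitive d c\<psi> primitive_on_subset[OF P]) linarith+
    also have "(LINT t:{a..b}|lborel. \<psi> t *\<^sub>R v t) = (LINT t:I|lborel. \<psi> t *\<^sub>R v t)"
      unfolding set_lebesgue_integral_def
    proof (intro Bochner_Integration.integral_cong refl)
      fix t
      show "indicator {a..b} t *\<^sub>R \<psi> t *\<^sub>R v t = indicator I t *\<^sub>R \<psi> t *\<^sub>R v t"
      proof (cases "t \<in> C")
        case True
        then have "t \<in> {a..b}" using ab(3) by auto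
        moreover from this have "t \<in> I" using ab(4) by blast
        ultimately show ?thesis by simp
      qed (simp add: C(3))
    qed
    finally show ?thesis .
  qed (simp add: set_lebesgue_integral_def)
qed

section \<open>The du Bois-Reymond lemma\<close>

lemma set_integrable_test_deriv:
  fixes f :: "real \<Rightarrow> 'a::{banach, second_countable_topology}"
  assumes t: "test_function I \<psi>" and f: "continuous_on I f"
  shows "set_integrable lborel I (\<lambda>t. deriv \<psi> t *\<^sub>R f t)"
proof -
  obtain C where C: "compact C" "C \<subseteq> I" "\<And>t. t \<notin> C \<Longrightarrow> deriv \<psi> t = 0"
    using test_function_deriv[OF t] by metis
  have "indicator I t *\<^sub>R deriv \<psi> t *\<^sub>R f t = indicator C t *\<^sub>R deriv \<psi> t *\<^sub>R f t" for t
    by (cases "t \<in> C") (use C in \<open>auto simp: indicator_def\<close>)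
  moreover have "continuous_on UNIV (deriv \<psi>)" using t by (simp add: test_function_def)
  then have "integrable lborel (\<lambda>t. indicator C t *\<^sub>R deriv \<psi> t *\<^sub>R f t)"
    by (intro borel_integrable_compact C(1) continuous_on_scaleR continuous_on_subset[OF f C(2)])
       (auto intro: continuous_on_subset)
  ultimately show ?thesis by (simp only: set_integrable_def)
qed

text \<open>Test with a function whose derivative is \<open>w (h - m)\<close>, where \<open>w\<close> is a positive weight
  vanishing at both ends and \<open>m\<close> is the \<open>w\<close>-mean of \<open>h\<close>: then \<open>\<integral> w (h - m)\<^sup>2 = 0\<close>.\<close>

lemma du_Bois_Reymond_Icc:
  fixes h :: "real \<Rightarrow> real"
  assumes h: "continuous_on {a..b} h" and ab: "a < b" and I: "{a..b} \<subseteq> I"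
    and z: "\<And>\<psi>. test_function I \<psi> \<Longrightarrow> (LINT t:I|lborel. deriv \<psi> t *\<^sub>R h t) = 0"
  obtains m where "\<And>t. a < t \<Longrightarrow> t < b \<Longrightarrow> h t = m"
proof -
  \<comment> \<open>Both functions live on the whole line: w is cut off to zero outside (a,b), and H
    continues h by its boundary values. Their combination \<eta> below then has a global
    antiderivative.\<close>
  define w where "w t = max 0 (t - a) * max 0 (b - t)" for t
  define H where "H t = h (max a (min b t))" for t
  have cw[continuous_intros]: "continuous_on S w" for S by (auto simp: w_def[abs_def] intro!: continuous_intros)
  have "continuous_on UNIV H" unfolding H_def
    by (intro continuous_on_compose2[OF h] continuous_intros) (use ab in auto)
  then have cH[continuous_intros]: "continuous_on S H" for S by (rule continuous_on_subset) simp
  have wnn: "w t \<ge> 0" for t by (simp add: w_def)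
  have wpos: "w t > 0" if "a < t" "t < b" for t using that by (simp add: w_def)
  have w0: "w t = 0" if "t \<le> a \<or> b \<le> t" for t using that by (auto simp: w_def)
  have W: "integral {a..b} w \<noteq> 0"
    using integral_eq_0_iff[OF cw ab wnn] wpos[of "(a+b)/2"] ab by force
  define m where "m = integral {a..b} (\<lambda>t. w t * H t) / integral {a..b} w"
  define \<eta> where "\<eta> t = w t * (H t - m)" for t
  have c\<eta>: "continuous_on S \<eta>" for S unfolding \<eta>_def[abs_def] by (intro continuous_intros)
  have int: "f integrable_on {a..b}" if "continuous_on {a..b} f" for f :: "real \<Rightarrow> real"
    using that by (rule integrable_continuous_real)
  have "integral {a..b} \<eta> = integral {a..b} (\<lambda>t. w t * H t - m * w t)"
    by (simp add: \<eta>_def[abs_def] algebra_simps)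
  also have "\<dots> = integral {a..b} (\<lambda>t. w t * H t) - integral {a..b} (\<lambda>t. m * w t)"
    by (intro integral_diff int continuous_intros)
  also have "\<dots> = 0" using W by (simp add: m_def)
  finally have \<eta>0: "integral {a..b} \<eta> = 0" .
  obtain F where F: "\<And>t. (F has_vector_derivative \<eta> t) (at t)"
    using einterval_antiderivative[of "-\<infinity>" "\<infinity>" \<eta>] c\<eta>[of UNIV]
    by (auto simp: continuous_on_eq_continuous_at)
  have FTC: "integral {s..t} \<eta> = F t - F s" if "s \<le> t" for s t
    using that F by (intro integral_unique fundamental_theorem_of_calculus) (auto intro: has_vector_derivative_at_within)
  define \<psi> where "\<psi> t = F t - F a" for t
  have d\<psi>: "(\<psi> has_real_derivative \<eta> t) (at t)" for t
    using F[of t] unfolding \<psi>_def has_real_derivative_iff_has_vector_derivative[symmetric]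
    by (auto intro!: derivative_eq_intros)
  then have D: "deriv \<psi> t = \<eta> t" for t by (rule DERIV_imp_deriv)
  \<comment> \<open>\<psi> is constant on either side of \<open>{a..b}\<close>, since \<eta>
    vanishes there. The left constant is 0 by the normalisation at a, the right one because the
    choice of m makes the total integral of \<eta> zero.\<close>
  have \<psi>0: "\<psi> t = 0" if "t \<notin> {a..b}" for t
  proof (cases "t < a")
    case True
    have "integral {t..a} \<eta> = integral {t..a} (\<lambda>_. 0)"
      by (intro integral_cong) (auto simp: \<eta>_def w0)
    then show ?thesis using FTC[of t a] True by (simp add: \<psi>_def)
  next
    case False
    then have bt: "b \<le> t" using that by simp
    have "integral {b..t} \<eta> = integral {b..t} (\<lambda>_. 0)"
      by (intro integral_cong) (auto simp: \<eta>_def w0)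
    then have "F t = F b" using FTC[OF bt] by simp
    moreover have "F b = F a" using FTC[of a b] ab \<eta>0 by simp
    ultimately show ?thesis by (simp add: \<psi>_def)
  qed
  have "test_function I \<psi>" unfolding test_function_def
  proof (intro conjI allI)
    show "\<psi> differentiable at t" for t using d\<psi>[of t] real_differentiable_def by blast
    show "continuous_on UNIV (deriv \<psi>)" using c\<eta>[of UNIV] by (simp add: D[abs_def])
    show "\<exists>C. compact C \<and> C \<subseteq> I \<and> (\<forall>t. t \<notin> C \<longrightarrow> \<psi> t = 0)"
      using \<psi>0 I by (intro exI[of _ "{a..b}"]) auto
  qed
  from z[OF this] have "0 = (LINT t:I|lborel. \<eta> t *\<^sub>R h t)" by (simp add: D)
  also have "\<dots> = (LINT t:{a..b}|lborel. \<eta> t * H t)"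
    unfolding set_lebesgue_integral_def
  proof (intro Bochner_Integration.integral_cong refl)
    fix t show "indicator I t *\<^sub>R \<eta> t *\<^sub>R h t = indicator {a..b} t *\<^sub>R (\<eta> t * H t)"
    proof (cases "t \<in> {a..b}")
      case True
      then have "t \<in> I" "H t = h t" using I by (auto simp: H_def)
      with True show ?thesis by simp
    next
      case False
      then have "\<eta> t = 0" by (auto simp: \<eta>_def w0)
      then show ?thesis by simp
    qed
  qed
  also have "\<dots> = integral {a..b} (\<lambda>t. \<eta> t * H t)"
    by (intro set_borel_integral_eq_integral(2)) (auto simp: set_integrable_def
        intro!: borel_integrable_compact[of "{a..b}" "\<lambda>t. \<eta> t * H t", simplified] continuous_intros c\<eta>)
  finally have 1: "integral {a..b} (\<lambda>t. \<eta> t * H t) = 0" by simp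
  have "integral {a..b} (\<lambda>t. w t * (H t - m)\<^sup>2) = integral {a..b} (\<lambda>t. \<eta> t * H t - m * \<eta> t)"
    by (simp add: \<eta>_def[abs_def] algebra_simps power2_eq_square)
  also have "\<dots> = integral {a..b} (\<lambda>t. \<eta> t * H t) - integral {a..b} (\<lambda>t. m * \<eta> t)"
    by (intro integral_diff int continuous_intros c\<eta>)
  also have "\<dots> = 0" using 1 \<eta>0 by simp
  finally have 2: "integral {a..b} (\<lambda>t. w t * (H t - m)\<^sup>2) = 0" .
  have "continuous_on {a..b} (\<lambda>t. w t * (H t - m)\<^sup>2)" by (intro continuous_intros)
  from integral_eq_0_iff[OF this ab] 2 wnn have 3: "\<forall>t\<in>{a..b}. w t * (H t - m)\<^sup>2 = 0" by simp
  have "h t = m" if "a < t" "t < b" for t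
    using 3[rule_format, of t] wpos[OF that] that by (simp add: H_def)
  then show ?thesis by (rule that)
qed

lemma du_Bois_Reymond:
  fixes g :: "real \<Rightarrow> real ^ 'n"
  assumes I: "open I" "is_interval I" and g: "continuous_on I g"
    and z: "\<And>\<psi>. test_function I \<psi> \<Longrightarrow> (LINT t:I|lborel. deriv \<psi> t *\<^sub>R g t) = 0"
    and ab: "a \<in> I" "b \<in> I"
  shows "g a = g b"
proof (rule vec_eq_iff[THEN iffD2], rule allI)
  fix k
  obtain c d where cd: "c < a" "d > a" "{a,b} \<subseteq> {c<..<d}" "{c..d} \<subseteq> I"
    using compact_in_interval_bounds[OF I _ _ ab(1), of "{a,b}"] ab(1,2)
    by (metis compact_insert compact_empty empty_subsetI insert_subset)
  have k: "(LINT t:I|lborel. deriv \<psi> t *\<^sub>R (g t $ k)) = 0" if t: "test_function I \<psi>" for \<psi>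
  proof -
    have "(LINT t:I|lborel. deriv \<psi> t *\<^sub>R (g t $ k)) = (LINT t|lborel. (indicator I t *\<^sub>R deriv \<psi> t *\<^sub>R g t) $ k)"
      by (simp add: set_lebesgue_integral_def mult.assoc)
    also have "\<dots> = (LINT t:I|lborel. deriv \<psi> t *\<^sub>R g t) $ k"
      unfolding set_lebesgue_integral_def
      using set_integrable_test_deriv[OF t g]
      by (intro integral_bounded_linear bounded_linear_vec_nth) (simp add: set_integrable_def)
    finally show ?thesis using z[OF t] by simp
  qed
  have "continuous_on {c..d} (\<lambda>t. g t $ k)"
    by (intro continuous_intros continuous_on_subset[OF g cd(4)])
  from du_Bois_Reymond_Icc[OF this _ cd(4) k] cd obtain m
    where "\<And>t. c < t \<Longrightarrow> t < d \<Longrightarrow> g t $ k = m" by auto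
  then show "g a $ k = g b $ k" using cd by simp
qed

lemma primitive_on_exists:
  assumes "open I" "is_interval I" "locally_integrable I v"
  obtains F where "primitive_on F v I"
proof (cases "I = {}")
  case False
  then obtain x where x: "x \<in> I" by auto
  have si: "set_integrable lborel {a..b} v" if "a \<in> I" "b \<in> I" for a b
    using that assms locally_integrable_iff by metis
  note in' = set_borel_integral_eq_integral[OF si]
  \<comment> \<open>The oriented integral from x to t: at most one of the two intervals is more than
    a point, so one of the terms vanishes.\<close>
  define F where "F t = integral {x..t} v - integral {t..x} v" for t
  have "primitive_on F v I" unfolding primitive_on_def
  proof safe
    fix a b assume ab: "a \<in> I" "b \<in> I" "a \<le> b"
    then show "set_integrable lborel {a..b} v" by (simp add: si)
    have "F b - F a = integral {a..b} v"
    proof -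
      consider "b \<le> x" | "a \<le> x" "x \<le> b" | "x \<le> a" using ab by linarith
      then show ?thesis
      proof cases
        case 1
        have "integral {x..b} v = 0" "integral {x..a} v = 0" using 1 ab by (cases "b = x"; cases "a = x"; simp)+
        then show ?thesis using Henstock_Kurzweil_Integration.integral_combine[OF ab(3) 1 in'(1)[OF ab(1) x]]
          by (simp add: F_def algebra_simps)
      next
        case 2
        have "integral {b..x} v = 0" "integral {x..a} v = 0" using 2 ab by (cases "b = x"; cases "a = x"; simp)+
        then show ?thesis using Henstock_Kurzweil_Integration.integral_combine[OF 2 in'(1)[OF ab(1,2)]]
          by (simp add: F_def algebra_simps)
      next
        case 3
        have "integral {b..x} v = 0" "integral {a..x} v = 0" using 3 ab by (cases "b = x"; cases "a = x"; simp)+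
        then show ?thesis using Henstock_Kurzweil_Integration.integral_combine[OF 3 ab(3) in'(1)[OF x ab(2)]]
          by (simp add: F_def algebra_simps)
      qed
    qed
    then show "F b - F a = (LINT t:{a..b}|lborel. v t)" using in'(2) ab by simp
  qed
  then show ?thesis by (rule that)
next
  case True
  then show ?thesis using that by (simp add: primitive_on_def)
qed

text \<open>\<phi> and a primitive F of v have the same weak derivative, so their difference is
  constant and \<phi> has the increments of F.\<close>

lemma weak_deriv_primitive_on:
  assumes I: "open I" "is_interval I" and c: "continuous_on I \<phi>" and w: "has_weak_deriv \<phi> v I"
  shows "primitive_on \<phi> v I"
proof -
  obtain F where F: "primitive_on F v I"
    using primitive_on_exists[OF I] w by (auto simp: has_weak_deriv_def)
  have cF: "continuous_on I F" by (rule primitive_on_continuous[OF I F])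
  have const: "\<phi> a - F a = \<phi> b - F b" if "a \<in> I" "b \<in> I" for a b
  proof (rule du_Bois_Reymond[OF I, of "\<lambda>t. \<phi> t - F t"])
    fix \<psi> assume t: "test_function I \<psi>"
    have "(LINT t:I|lborel. deriv \<psi> t *\<^sub>R (\<phi> t - F t))
        = (LINT t:I|lborel. deriv \<psi> t *\<^sub>R \<phi> t) - (LINT t:I|lborel. deriv \<psi> t *\<^sub>R F t)"
      unfolding scaleR_diff_right
      by (intro set_integral_diff set_integrable_test_deriv[OF t] c cF)
    also have "\<dots> = 0"
      using w primitive_on_weak_deriv[OF I F] t by (simp add: has_weak_deriv_def)
    finally show "(LINT t:I|lborel. deriv \<psi> t *\<^sub>R (\<phi> t - F t)) = 0" .
  qed (use that c cF in \<open>auto intro: continuous_intros\<close>)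
  have "\<phi> b - \<phi> a = F b - F a" if "a \<in> I" "b \<in> I" for a b
    using const[OF that] by (simp add: algebra_simps)
  then show ?thesis using F by (simp add: primitive_on_def)
qed

section \<open>Almost everywhere uniqueness of the integrand\<close>

text \<open>A Dynkin argument: the Borel sets over which the truncated u integrates to 0 are closed
  under complements and countable disjoint unions, and they contain the half-lines
  \<open>{..c}\<close>, an intersection-stable generator.\<close>

lemma AE_zero_if_integral_Icc_zero:
  fixes u :: "real \<Rightarrow> 'a::{banach, second_countable_topology}"
  assumes u: "set_integrable lborel {a..b} u"
    and z: "\<And>c d. c \<in> {a..b} \<Longrightarrow> d \<in> {a..b} \<Longrightarrow> c \<le> d \<Longrightarrow> (LINT t:{c..d}|lborel. u t) = 0"
  shows "AE t in lborel. t \<in> {a..b} \<longrightarrow> u t = 0"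
proof -
  define f where "f t = indicator {a..b} t *\<^sub>R u t" for t
  have f: "integrable lborel f" using u by (simp add: set_integrable_def f_def[abs_def])
  have fA: "set_integrable lborel A f" if "A \<in> sets borel" for A
    unfolding set_integrable_def using f that by (intro integrable_mult_indicator) auto
  have tot: "integral\<^sup>L lborel f = 0"
  proof (cases "a \<le> b")
    case True
    then show ?thesis using z[of a b] by (simp add: f_def[abs_def] set_lebesgue_integral_def)
  qed (simp add: f_def[abs_def])
  have ist: "Int_stable (range (\<lambda>c::real. {..c}))" by (auto simp: Int_stable_def)
  have cl: "range (\<lambda>c::real. {..c}) \<subseteq> Pow UNIV" by simp
  have "(LINT t:A|lborel. f t) = 0" if "A \<in> sigma_sets UNIV (range (\<lambda>c::real. {..c}))" for A
    using ist cl that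
  proof (induction rule: sigma_sets_induct_disjoint)
    case (basic A)
    then obtain c where A: "A = {..c}" by auto
    show ?case
    proof (cases "a \<le> b \<and> a \<le> c")
      case True
      have "(LINT t:A|lborel. f t) = (LINT t:{a..min b c}|lborel. u t)"
        unfolding set_lebesgue_integral_def f_def A
        by (intro Bochner_Integration.integral_cong) (auto simp: indicator_def)
      then show ?thesis using z[of a "min b c"] True by simp
    next
      case False
      then have "(\<lambda>t. indicator A t *\<^sub>R f t) = (\<lambda>_. 0)" by (auto simp: A f_def indicator_def fun_eq_iff)
      then show ?thesis by (simp add: set_lebesgue_integral_def)
    qed
  next
    case empty
    show ?case by (simp add: set_lebesgue_integral_def)
  next
    case (compl A)
    have A: "A \<in> sets borel" using compl(1) by (simp add: borel_eq_atMost)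
    have "(LINT t:UNIV - A|lborel. f t) = (LINT t|lborel. f t - indicator A t *\<^sub>R f t)"
      unfolding set_lebesgue_integral_def
      by (intro Bochner_Integration.integral_cong) (auto simp: indicator_def)
    also have "\<dots> = integral\<^sup>L lborel f - (LINT t:A|lborel. f t)"
      unfolding set_lebesgue_integral_def using f fA[OF A]
      by (intro Bochner_Integration.integral_diff) (auto simp: set_integrable_def)
    finally show ?case using compl tot by simp
  next
    case (union A)
    have A: "A i \<in> sets borel" for i using union(2) by (auto simp: borel_eq_atMost)
    have "(LINT t:(\<Union>i. A i)|lborel. f t) = (\<Sum>i. (LINT t:(A i)|lborel. f t))"
      using A union(1) by (intro lebesgue_integral_countable_add fA) (auto simp: disjoint_family_on_def)
    then show ?case using union(3) by simp
  qed
  then have "AE t in lborel. f t = 0"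
    by (intro sigma_finite_measure.density_zero[OF lborel.sigma_finite_measure_axioms] f) (simp add: borel_eq_atMost)
  then show ?thesis by (auto simp: f_def elim!: eventually_mono)
qed

text \<open>The null set found for one compact interval depends on that interval. Intervals with
  rational endpoints are countable in number and still cover the open I, so a single null set
  suffices.\<close>

lemma primitive_on_unique:
  assumes I: "open I" "is_interval I" and v: "primitive_on \<phi> v I" and w: "primitive_on \<phi> w I"
  shows "AE t in lborel. t \<in> I \<longrightarrow> v t = w t"
proof -
  have "AE t in lborel. p \<in> I \<and> q \<in> I \<longrightarrow> t \<in> {p..q} \<longrightarrow> v t - w t = 0" for p q
  proof (cases "p \<in> I \<and> q \<in> I \<and> p \<le> q")
    case True
    have sub: "{p..q} \<subseteq> I" using True I(2) unfolding is_interval_1 by (meson atLeastAtMost_iff subsetI)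
    have "AE t in lborel. t \<in> {p..q} \<longrightarrow> v t - w t = 0"
    proof (rule AE_zero_if_integral_Icc_zero)
      show "set_integrable lborel {p..q} (\<lambda>t. v t - w t)"
        using True v w by (intro set_integral_diff) (auto simp: primitive_on_def)
      fix c d assume "c \<in> {p..q}" "d \<in> {p..q}" "c \<le> d"
      then have cd: "c \<in> I" "d \<in> I" "c \<le> d" using sub by auto
      show "(LINT t:{c..d}|lborel. v t - w t) = 0"
        using primitive_onD[OF v cd] primitive_onD[OF w cd] by (simp add: set_integral_diff)
    qed
    then show ?thesis using True by simp
  next
    case False
    then have "p \<in> I \<Longrightarrow> q \<in> I \<Longrightarrow> {p..q} = {}" by auto
    then show ?thesis by (intro AE_I2) blast
  qed
  then have "AE t in lborel. \<forall>p\<in>\<rat>. \<forall>q\<in>\<rat>. p \<in> I \<and> q \<in> I \<longrightarrow> t \<in> {p..q} \<longrightarrow> v t - w t = 0"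
    by (simp add: AE_ball_countable countable_rat)
  then show ?thesis
  proof eventually_elim
    case (elim t)
    show ?case
    proof
      assume t: "t \<in> I"
      obtain a b where ab: "a < t" "t < b" "{a..b} \<subseteq> I"
        using compact_in_interval_bounds[OF I compact_empty empty_subsetI t] by metis
      obtain p q where "p \<in> \<rat>" "a < p" "p < t" "q \<in> \<rat>" "t < q" "q < b"
        using Rats_dense_in_real ab(1,2) by metis
      then show "v t = w t" using elim[rule_format, of p q] ab(3) by (auto simp: subset_iff)
    qed
  qed
qed

section \<open>Lifts of maps into the torus\<close>

lemma to_circ_eq_iff: "to_circ x = to_circ y \<longleftrightarrow> (\<exists>k::int. x - y = 2 * pi * of_int k)"
  using circ.abs_eq_iff[of x y] by (simp add: cong_2pi_def)

lemma to_torus_eq_iff: "to_torus x = to_torus y \<longleftrightarrow> (\<forall>i. \<exists>k::int. x $ i - y $ i = 2 * pi * of_int k)"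
  by (simp add: to_torus_def vec_eq_iff to_circ_eq_iff)

lemma to_torus_add_cong: "to_torus x = to_torus y \<Longrightarrow> to_torus (x + z) = to_torus (y + z)"
  by (simp add: to_torus_eq_iff)

lemma to_torus_surj: obtains x where "to_torus x = \<Phi>"
proof
  show "to_torus (\<chi> i. rep_circ (\<Phi> $ i)) = \<Phi>"
    by (simp add: to_torus_def vec_eq_iff Quotient3_abs_rep[OF Quotient3_circ])
qed

lemma continuous_on_to_torus: "continuous_on S to_torus"
proof -
  have "continuous_on UNIV to_circ"
    by (auto simp: continuous_on_open_vimage open_circ_def)
  then have "continuous_on UNIV (\<lambda>x::real^'n. to_circ (x $ i))" for i
    by (rule continuous_on_compose2) (auto intro: continuous_intros)
  then have "continuous_on UNIV (to_torus :: real^'n \<Rightarrow> _)"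
    unfolding to_torus_def[abs_def] by (intro continuous_on_vec_lambda)
  then show ?thesis by (rule continuous_on_subset) simp
qed

text \<open>The circle maps continuously and injectively into the complex plane by
  \<open>cis\<close>, so uniqueness of limits is inherited from there, component by
  component.\<close>

lemma tendsto_to_torus_unique:
  assumes X: "(X \<longlongrightarrow> to_torus a) F" "(X \<longlongrightarrow> to_torus b) F" and F: "F \<noteq> bot"
  shows "to_torus a = to_torus b"
proof -
  \<comment> \<open>\<open>rep_circ\<close> picks arbitrary representatives and need not be
    continuous. By periodicity \<open>cis\<close> does not see the choice, and continuity is checked
    on preimages under the quotient map.\<close>
  define e where "e c = cis (rep_circ c)" for c
  have e: "e (to_circ x) = cis x" for x
  proof -
    have "to_circ (rep_circ (to_circ x)) = to_circ x"
      by (rule Quotient3_abs_rep[OF Quotient3_circ])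
    then obtain k :: int where "rep_circ (to_circ x) = x + 2 * pi * of_int k"
      unfolding to_circ_eq_iff by (auto simp: algebra_simps)
    then show ?thesis unfolding e_def using sin_cos_eq_iff[of "rep_circ (to_circ x)" x]
      by (auto simp: complex_eq_iff)
  qed
  have "continuous_on UNIV e"
  proof -
    have "open (e -` B)" if "open B" for B
    proof -
      have "to_circ -` (e -` B) = cis -` B" by (auto simp: e)
      moreover have "open (cis -` B)" using that
        by (intro open_vimage) (auto simp: cis_conv_exp intro!: continuous_intros)
      ultimately show ?thesis by (simp add: open_circ_def)
    qed
    then show ?thesis by (simp add: continuous_on_open_vimage)
  qed
  then have ce: "((\<lambda>t. e (Y t)) \<longlongrightarrow> e c) F" if "(Y \<longlongrightarrow> c) F" for Y c
    using that by (rule continuous_on_tendsto_compose) auto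
  have "to_circ (a $ i) = to_circ (b $ i)" for i
  proof -
    have "((\<lambda>t. X t $ i) \<longlongrightarrow> to_circ (a $ i)) F" "((\<lambda>t. X t $ i) \<longlongrightarrow> to_circ (b $ i)) F"
      using X[THEN tendsto_vec_nth, of i] by (simp_all add: to_torus_def)
    from this[THEN ce]
    have "cis (a $ i) = cis (b $ i)" using F by (auto simp: e intro: tendsto_unique)
    then show ?thesis using sin_cos_eq_iff[of "a $ i" "b $ i"]
      by (auto simp: complex_eq_iff to_circ_eq_iff)
  qed
  then show ?thesis by (simp add: to_torus_def)
qed

text \<open>Each component of the difference is continuous with values in the multiples of 2 pi.
  Distinct values are at least 2 pi apart, so the component is constant on a connected set.\<close>

lemma lifts_differ_by_constant:
  fixes \<phi> \<phi>' :: "real \<Rightarrow> real ^ 'n"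
  assumes I: "connected I" and c: "continuous_on I \<phi>" "continuous_on I \<phi>'"
    and e: "\<And>t. t \<in> I \<Longrightarrow> to_torus (\<phi> t) = to_torus (\<phi>' t)"
  obtains d where "\<And>t. t \<in> I \<Longrightarrow> \<phi>' t = \<phi> t + d"
proof -
  have "\<exists>d. \<forall>t\<in>I. \<phi>' t $ i - \<phi> t $ i = d" for i
  proof -
    have "(\<lambda>t. \<phi>' t $ i - \<phi> t $ i) constant_on I"
    proof (rule continuous_discrete_range_constant[OF I])
      show "continuous_on I (\<lambda>t. \<phi>' t $ i - \<phi> t $ i)" by (intro continuous_intros c)
      fix x assume x: "x \<in> I"
      have k: "\<exists>k::int. \<phi>' t $ i - \<phi> t $ i = 2 * pi * of_int k" if "t \<in> I" for t
        using e[OF that, symmetric] unfolding to_torus_eq_iff by blast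
      have "2 * pi \<le> norm (\<phi>' y $ i - \<phi> y $ i - (\<phi>' x $ i - \<phi> x $ i))"
        if y: "y \<in> I" "\<phi>' y $ i - \<phi> y $ i \<noteq> \<phi>' x $ i - \<phi> x $ i" for y
      proof -
        obtain k l :: int where kl: "\<phi>' x $ i - \<phi> x $ i = 2 * pi * of_int k" "\<phi>' y $ i - \<phi> y $ i = 2 * pi * of_int l"
          using k x y(1) by meson
        then have "k \<noteq> l" using y by auto
        then have "1 \<le> \<bar>l - k\<bar>" by linarith
        then have "(1::real) \<le> \<bar>of_int l - of_int k\<bar>" by (metis of_int_1_le_iff of_int_abs of_int_diff)
        then have "2 * pi * 1 \<le> 2 * pi * \<bar>of_int l - of_int k\<bar>" by (intro mult_left_mono) auto
        also have "\<dots> = norm (2 * pi * of_int l - 2 * pi * of_int k)"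
          by (simp add: abs_mult flip: right_diff_distrib)
        finally show ?thesis by (simp add: kl)
      qed
      then show "\<exists>e>0. \<forall>y. y \<in> I \<and> \<phi>' y $ i - \<phi> y $ i \<noteq> \<phi>' x $ i - \<phi> x $ i \<longrightarrow>
          e \<le> norm (\<phi>' y $ i - \<phi> y $ i - (\<phi>' x $ i - \<phi> x $ i))"
        by (intro exI[of _ "2 * pi"]) auto
    qed
    then show ?thesis by (simp add: constant_on_def)
  qed
  then obtain d where "\<And>i t. t \<in> I \<Longrightarrow> \<phi>' t $ i - \<phi> t $ i = d i" by metis
  then have "\<phi>' t = \<phi> t + (\<chi> i. d i)" if "t \<in> I" for t
    using that by (simp add: vec_eq_iff algebra_simps)
  then show ?thesis by (rule that)
qed

text \<open>After this equivalence test functions no longer appear: torus-valued maps are handled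
  through lifts that are primitives.\<close>

lemma torus_weak_deriv_iff_primitive_on:
  assumes "open I" "is_interval I"
  shows "torus_weak_deriv \<Phi> v I \<longleftrightarrow> (\<exists>\<phi>. primitive_on \<phi> v I \<and> (\<forall>t\<in>I. \<Phi> t = to_torus (\<phi> t)))"
  unfolding torus_weak_deriv_def
  using weak_deriv_primitive_on[OF assms] primitive_on_weak_deriv[OF assms] primitive_on_continuous[OF assms]
  by metis

lemma primitive_on_lift_cong:
  assumes I: "open I" "is_interval I"
    and \<phi>: "primitive_on \<phi> v I" and \<phi>': "primitive_on \<phi>' w I"
    and e: "\<And>t. t \<in> I \<Longrightarrow> to_torus (\<phi> t) = to_torus (\<phi>' t)"
  obtains d where "\<And>t. t \<in> I \<Longrightarrow> \<phi>' t = \<phi> t + d" "AE t in lborel. t \<in> I \<longrightarrow> v t = w t"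
proof -
  have "connected I" using I(2) is_interval_connected by blast
  then obtain d where d: "\<And>t. t \<in> I \<Longrightarrow> \<phi>' t = \<phi> t + d"
    using lifts_differ_by_constant primitive_on_continuous[OF I] \<phi> \<phi>' e by metis
  have "primitive_on \<phi> w I" using \<phi>' d by (auto simp: primitive_on_def)
  from primitive_on_unique[OF I \<phi> this] d show ?thesis using that by blast
qed

lemma torus_weak_deriv_unique:
  assumes I: "open I" "is_interval I"
    and "torus_weak_deriv \<Phi> v I" "torus_weak_deriv \<Phi> w I"
  shows "AE t in lborel. t \<in> I \<longrightarrow> v t = w t"
  using assms(3,4) unfolding torus_weak_deriv_iff_primitive_on[OF I]
  by (metis primitive_on_lift_cong[OF I])

text \<open>Every bounded interval comes with its own lift and its own derivative. On overlaps the
  lifts differ by constants and the derivatives agree almost everywhere, so after normalisation they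
  glue to one lift and one integrand on the half-line.\<close>

lemma H1_loc_torus_weak_deriv:
  assumes "\<Phi> \<in> H1_loc"
  obtains v where "torus_weak_deriv \<Phi> v {0<..}"
proof -
  define J where "J n = {0<..<real (Suc n)}" for n
  have J: "open (J n)" "is_interval (J n)" for n by (auto simp: J_def is_interval_oo)
  have "\<exists>v \<phi>. v \<in> L2 (J n) \<and> primitive_on \<phi> v (J n) \<and> (\<forall>t\<in>J n. \<Phi> t = to_torus (\<phi> t))" for n
  proof -
    have "\<Phi> \<in> H1 (real (Suc n))" using assms by (simp add: H1_loc_def)
    then obtain v where "v \<in> L2 (J n)" "torus_weak_deriv \<Phi> v (J n)" by (auto simp: H1_def J_def)
    then show ?thesis unfolding torus_weak_deriv_iff_primitive_on[OF J] by blast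
  qed
  then obtain v \<phi> where v: "\<And>n. v n \<in> L2 (J n)" and \<phi>: "\<And>n. primitive_on (\<phi> n) (v n) (J n)"
    and \<Phi>: "\<And>n t. t \<in> J n \<Longrightarrow> \<Phi> t = to_torus (\<phi> n t)" by metis
  have both: "\<exists>d. \<forall>t\<in>J m. \<phi> n t = \<phi> m t + d" "AE t in lborel. t \<in> J m \<longrightarrow> v m t = v n t" if "m \<le> n" for m n
  proof -
    have sub: "J m \<subseteq> J n" using that by (auto simp: J_def)
    have "primitive_on (\<phi> n) (v n) (J m)" by (rule primitive_on_subset[OF \<phi> sub])
    from primitive_on_lift_cong[OF J \<phi> this] \<Phi> sub
    obtain d where "\<And>t. t \<in> J m \<Longrightarrow> \<phi> n t = \<phi> m t + d" "AE t in lborel. t \<in> J m \<longrightarrow> v m t = v n t"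
      by (metis subsetD)
    then show "\<exists>d. \<forall>t\<in>J m. \<phi> n t = \<phi> m t + d" "AE t in lborel. t \<in> J m \<longrightarrow> v m t = v n t" by auto
  qed
  have h: "1/2 \<in> J n" for n by (auto simp: J_def)
  \<comment> \<open>Normalising all lifts at time \<open>1/2\<close> makes them agree on overlaps.\<close>
  define g where "g n t = \<phi> n t - \<phi> n (1/2) + \<phi> 0 (1/2)" for n t
  \<comment> \<open>\<open>J n\<close> ends at n + 1, so the ceiling of a positive t is an index
    whose open interval contains t.\<close>
  define N where "N t = nat \<lceil>t\<rceil>" for t :: real
  have N: "t \<in> J (N t)" if "0 < t" for t
    using that by (simp add: J_def N_def) linarith
  have Nmono: "N s \<le> N t" if "s \<le> t" for s t using that unfolding N_def by (intro nat_mono ceiling_mono)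
  have g\<Phi>: "to_torus (g n t) = \<Phi> t" if "t \<in> J n" for n t
  proof -
    have "to_torus (\<phi> 0 (1/2)) = to_torus (\<phi> n (1/2))" using \<Phi>[OF h] by metis
    from to_torus_add_cong[OF this, of "\<phi> n t - \<phi> n (1/2)"] show ?thesis
      using \<Phi>[OF that] by (simp add: g_def add.commute)
  qed
  have gprim: "primitive_on (g n) (v n) (J n)" for n
    using \<phi>[of n] by (simp add: primitive_on_def g_def)
  have geq: "g n t = g m t" if "m \<le> n" "t \<in> J m" for m n t
  proof -
    obtain d where "\<forall>t\<in>J m. \<phi> n t = \<phi> m t + d" using both(1)[OF \<open>m \<le> n\<close>] by blast
    then show ?thesis using h that(2) by (simp add: g_def)
  qed
  \<comment> \<open>Extended by zero, each \<open>v n\<close> is Borel on the whole line; V then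
    selects among countably many Borel functions by a measurable index.\<close>
  define w where "w n t = indicator (J n) t *\<^sub>R v n t" for n t
  define V where "V t = w (N t) t" for t
  have [measurable]: "w n \<in> borel_measurable borel" for n
    using v[of n] by (simp add: L2_def set_borel_measurable_def w_def[abs_def])
  have [measurable]: "N \<in> borel \<rightarrow>\<^sub>M count_space UNIV" unfolding N_def by measurable
  have [measurable]: "V \<in> borel_measurable borel" unfolding V_def
    by (rule measurable_compose_countable[where f=w and g=N]) measurable
  \<comment> \<open>Every index \<open>N t\<close> with t in \<open>{a..b}\<close> is at most
    \<open>N b\<close>, so V can be compared there with the single function
    \<open>v (N b)\<close>.\<close>
  have AEV: "AE t in lborel. t \<in> {a..b} \<longrightarrow> V t = v (N b) t" if "0 < a" for a b
  proof -
    have "AE t in lborel. \<forall>m. m \<le> N b \<longrightarrow> t \<in> J m \<longrightarrow> v m t = v (N b) t"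
      using both(2) by (intro AE_all_countable[THEN iffD2] allI) (auto intro!: AE_impI)
    then show ?thesis
    proof eventually_elim
      case (elim t)
      show ?case using elim N[of t] Nmono[of t b] \<open>0 < a\<close> by (auto simp: V_def w_def)
    qed
  qed
  have "primitive_on (\<lambda>t. g (N t) t) V {0<..}" unfolding primitive_on_def
  proof (intro ballI impI)
    fix a b :: real assume ab: "a \<in> {0<..}" "b \<in> {0<..}" "a \<le> b"
    then have J': "a \<in> J (N b)" "b \<in> J (N b)" using N[of b] by (auto simp: J_def)
    have i: "set_integrable lborel {a..b} (v (N b))" "g (N b) b - g (N b) a = (LINT t:{a..b}|lborel. v (N b) t)"
      using primitive_onD[OF gprim J' ab(3)] .
    have AE: "AE t in lborel. indicator {a..b} t *\<^sub>R v (N b) t = indicator {a..b} t *\<^sub>R V t"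
      using AEV[of a b] ab by (auto elim!: eventually_mono simp: indicator_def)
    have [measurable]: "(\<lambda>t. indicator {a..b} t *\<^sub>R v (N b) t) \<in> borel_measurable lborel"
      using i(1) by (auto simp: set_integrable_def)
    have "integrable lborel (\<lambda>t. indicator {a..b} t *\<^sub>R V t)"
      by (rule integrable_cong_AE_imp[OF i(1)[unfolded set_integrable_def] _ AE]) measurable
    moreover have "(LINT t:{a..b}|lborel. v (N b) t) = (LINT t:{a..b}|lborel. V t)"
      unfolding set_lebesgue_integral_def by (rule integral_cong_AE[OF _ _ AE]) measurable
    moreover have "g (N b) a = g (N a) a" using ab N[of a] Nmono by (intro geq) auto
    ultimately show "set_integrable lborel {a..b} V \<and> g (N b) b - g (N a) a = (LINT t:{a..b}|lborel. V t)"
      using i(2) by (simp add: set_integrable_def)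
  qed
  then have "torus_weak_deriv \<Phi> V {0<..}"
    using g\<Phi> N by (subst torus_weak_deriv_iff_primitive_on) (auto simp: is_interval_1)
  then show ?thesis by (rule that)
qed

section \<open>Admissible trajectories as primitives of square integrable functions\<close>

text \<open>Taken on the whole line: velocities, which live on positive times, get extended by
  zero.\<close>

definition square_integrable :: "(real \<Rightarrow> real ^ 'n) \<Rightarrow> bool" where
  "square_integrable u \<longleftrightarrow> u \<in> borel_measurable borel \<and> integrable lborel (\<lambda>t. (norm (u t))\<^sup>2)"

lemma square_integrable_set_integrable:
  assumes "square_integrable u"
  shows "set_integrable lborel {a..b} u"
  unfolding set_integrable_def
proof (rule Bochner_Integration.integrable_bound)
  show "integrable lborel (\<lambda>t. indicator {a..b} t + (norm (u t))\<^sup>2)"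
    using assms by (intro Bochner_Integration.integrable_add integrable_real_indicator)
      (auto simp: square_integrable_def emeasure_lborel_Icc_eq)
  show "(\<lambda>t. indicator {a..b} t *\<^sub>R u t) \<in> borel_measurable lborel"
    using assms by (intro borel_measurable_scaleR) (auto simp: square_integrable_def)
  have "x \<le> 1 + x\<^sup>2" for x :: real
  proof -
    have "2 * x \<le> x\<^sup>2 + 1" using sum_squares_bound[of x 1] by simp
    then show ?thesis using zero_le_power2[of x] by linarith
  qed
  then show "AE t in lborel. norm (indicator {a..b} t *\<^sub>R u t) \<le> norm (indicator {a..b} t + (norm (u t))\<^sup>2)"
    by (intro AE_I2) (auto simp: indicator_def)
qed

definition path_from :: "real ^ 'n \<Rightarrow> (real \<Rightarrow> real ^ 'n) \<Rightarrow> real \<Rightarrow> real ^ 'n" where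
  "path_from x u t = x + (LINT s:{0..t}|lborel. u s)"

lemma path_from_primitive:
  assumes "square_integrable u"
  shows "primitive_on (path_from x u) u {0..}"
  unfolding primitive_on_def
proof (intro ballI impI conjI)
  fix a b :: real assume ab: "a \<in> {0..}" "b \<in> {0..}" "a \<le> b"
  note si = square_integrable_set_integrable[OF assms]
  note in' = set_borel_integral_eq_integral[OF si]
  show "set_integrable lborel {a..b} u" by (rule si)
  show "path_from x u b - path_from x u a = (LINT t:{a..b}|lborel. u t)"
    using Henstock_Kurzweil_Integration.integral_combine[of 0 a b u] in'(1) ab
    by (simp add: path_from_def in'(2) algebra_simps)
qed

lemma path_from_0: "path_from x u 0 = x"
proof -
  have "(LINT s:{0..0}|lborel. u s) = 0"
    unfolding set_lebesgue_integral_def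
    by (rule integral_eq_zero_AE, rule eventually_mono[OF AE_lborel_singleton[of "0::real"]]) (auto simp: indicator_def)
  then show ?thesis by (simp add: path_from_def)
qed

lemma path_from_continuous:
  assumes "square_integrable u"
  shows "continuous_on {0..T} (path_from x u)"
  by (rule primitive_on_continuous_Icc[OF primitive_on_subset[OF path_from_primitive[OF assms]]]) auto

lemma path_from_add: "path_from x u t = x + path_from 0 u t"
  by (simp add: path_from_def)

text \<open>Integrability of v is known only on compact subintervals of the open half-line, so
  measurability is obtained as a limit of truncations to such intervals.\<close>

lemma primitive_on_measurable:
  assumes "primitive_on \<phi> v {0<..}"
  shows "(\<lambda>t. indicator {0<..} t *\<^sub>R v t) \<in> borel_measurable borel"
proof (rule borel_measurable_LIMSEQ_metric)
  let ?f = "\<lambda>n t. indicator {1/real (Suc n)..real (Suc n)} t *\<^sub>R v t"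
  show "?f n \<in> borel_measurable borel" for n
  proof -
    have "1 / real (Suc n) \<le> real (Suc n)" by (simp add: field_simps)
    then have "set_integrable lborel {1/real (Suc n)..real (Suc n)} v"
      using assms by (auto simp: primitive_on_def)
    then show ?thesis by (auto simp: set_integrable_def)
  qed
  show "(\<lambda>n. ?f n t) \<longlonglongrightarrow> indicator {0<..} t *\<^sub>R v t" for t
  proof (cases "0 < t")
    case True
    obtain N where N: "1 / t < real N" "t < real N" using reals_Archimedean2[of "max (1/t) t"] by auto
    have "eventually (\<lambda>n. ?f n t = indicator {0<..} t *\<^sub>R v t) sequentially"
      using eventually_ge_at_top[of N]
    proof eventually_elim
      case (elim n)
      then have "1 / t < real (Suc n)" "t < real (Suc n)" using N by auto
      then have "1 / real (Suc n) \<le> t" "t \<le> real (Suc n)" using True by (auto simp: field_simps)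
      then show ?case using True by simp
    qed
    then show ?thesis by (rule tendsto_eventually)
  next
    case False
    have "0 < 1 / real (Suc n)" for n by simp
    then have "t \<notin> {1/real (Suc n)..real (Suc n)}" for n using False by (meson atLeastAtMost_iff less_le_trans)
    then have "?f n t = indicator {0<..} t *\<^sub>R v t" for n using False by (metis greaterThan_iff indicator_simps(2))
    then show ?thesis by (simp only: tendsto_const)
  qed
qed

text \<open>Nonnegativity of Q lets the Lagrangian dominate each of its two parts, so the energies
  separate. The lift found on positive times may start at another preimage c of the initial point;
  the shift from c to x is invisible after projection, so the same u started at x describes the same
  trajectory.\<close>

lemma admissible_imp_path_from:
  fixes \<Psi> :: "real \<Rightarrow> 'n::finite torus"
  assumes \<Psi>: "\<Psi> \<in> admissible Q (to_torus x)"
    and Qnn: "\<And>\<theta>. 0 \<le> Q \<theta>"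
  obtains u where "square_integrable u" "\<And>t. 0 \<le> t \<Longrightarrow> \<Psi> t = to_torus (path_from x u t)"
    "set_integrable lborel {0<..} (\<lambda>t. Q (\<Psi> t))"
    "action Q \<Psi> = 1/2 * (LINT t|lborel. (norm (u t))\<^sup>2) + (LINT t:{0<..}|lborel. Q (\<Psi> t))"
proof -
  have H1: "\<Psi> \<in> H1_loc" and \<Psi>0: "\<Psi> 0 = to_torus x" and L: "set_integrable lborel {0<..} (lagrangian Q \<Psi>)"
    using \<Psi> by (auto simp: admissible_def)
  define v where "v = velocity \<Psi>"
  have J: "open {0::real<..}" "is_interval {0::real<..}" by (auto simp: is_interval_1)
  have "\<exists>v. torus_weak_deriv \<Psi> v {0<..}" using H1_loc_torus_weak_deriv[OF H1] by blast
  then have "torus_weak_deriv \<Psi> v {0<..}" unfolding v_def velocity_def by (rule someI_ex)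
  then obtain \<phi> where \<phi>: "primitive_on \<phi> v {0<..}" and \<Psi>\<phi>: "\<And>t. 0 < t \<Longrightarrow> \<Psi> t = to_torus (\<phi> t)"
    unfolding torus_weak_deriv_iff_primitive_on[OF J] by auto
  define u where "u t = indicator {0<..} t *\<^sub>R v t" for t
  have um [measurable]: "u \<in> borel_measurable borel" unfolding u_def by (rule primitive_on_measurable[OF \<phi>])
  have L': "integrable lborel (\<lambda>t. indicator {0<..} t * lagrangian Q \<Psi> t)"
    using L by (simp add: set_integrable_def)
  have u2: "integrable lborel (\<lambda>t. (norm (u t))\<^sup>2)"
  proof (rule Bochner_Integration.integrable_bound)
    show "integrable lborel (\<lambda>t. 2 * (indicator {0<..} t * lagrangian Q \<Psi> t))" using L' by simp
    show "AE t in lborel. norm ((norm (u t))\<^sup>2) \<le> norm (2 * (indicator {0<..} t * lagrangian Q \<Psi> t))"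
      using Qnn by (intro AE_I2) (auto simp: u_def v_def lagrangian_def indicator_def)
  qed measurable
  have u: "square_integrable u" using um u2 by (simp add: square_integrable_def)
  have eq: "indicator {0<..} t * Q (\<Psi> t) = indicator {0<..} t * lagrangian Q \<Psi> t - 1/2 * (norm (u t))\<^sup>2" for t
    by (auto simp: u_def v_def lagrangian_def indicator_def)
  have Qi: "integrable lborel (\<lambda>t. indicator {0<..} t * Q (\<Psi> t))"
    unfolding eq using L' u2 by auto
  have act: "action Q \<Psi> = 1/2 * (LINT t|lborel. (norm (u t))\<^sup>2) + (LINT t:{0<..}|lborel. Q (\<Psi> t))"
    unfolding action_def set_lebesgue_integral_def real_scaleR_def eq using L' u2 by simp
  \<comment> \<open>c is the value at time 0 to which the lift extends. It is read off at time 1,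
    because \<phi> is controlled only at positive times.\<close>
  define c where "c = \<phi> 1 - path_from 0 u 1"
  have c: "\<phi> t = path_from c u t" if "0 < t" for t
  proof -
    have I: "(LINT s:{a..b}|lborel. v s) = (LINT s:{a..b}|lborel. u s)" if "0 < a" for a b
      unfolding set_lebesgue_integral_def u_def using that
      by (intro Bochner_Integration.integral_cong) (auto simp: indicator_def)
    have "\<phi> b - \<phi> a = path_from 0 u b - path_from 0 u a" if "0 < a" "a \<le> b" for a b
      using primitive_onD(2)[OF \<phi>, of a b] primitive_onD(2)[OF path_from_primitive[OF u], of a b 0] that I
      by simp
    from this[of t 1] this[of 1 t] have "\<phi> t - \<phi> 1 = path_from 0 u t - path_from 0 u 1"
      using that by (cases "t \<le> 1") (auto simp: algebra_simps)
    then show ?thesis unfolding path_from_add[of c u t] by (simp add: c_def algebra_simps)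
  qed
  \<comment> \<open>Trajectory and lift are related at positive times only, so the starting points
    are compared along times decreasing to 0, where both sides are continuous.\<close>
  define X where "X n = 1 / real (Suc n)" for n
  have X: "X \<longlonglongrightarrow> 0" "\<And>n. X n \<in> {0..1}" "\<And>n. 0 < X n"
    unfolding X_def by (rule LIMSEQ_Suc[OF lim_1_over_n]) (auto simp: field_simps)
  have "continuous_on {0..1} \<Psi>" using H1 by (auto simp: H1_loc_def H1_def)
  then have l1: "(\<lambda>n. \<Psi> (X n)) \<longlonglongrightarrow> to_torus x"
    using continuous_on_tendsto_compose[of "{0..1}" \<Psi> X 0 sequentially] X \<Psi>0 by simp
  have "continuous_on {0..1} (\<lambda>t. to_torus (path_from c u t))"
    by (rule continuous_on_compose2[OF continuous_on_to_torus path_from_continuous[OF u]]) auto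
  then have "(\<lambda>n. to_torus (path_from c u (X n))) \<longlonglongrightarrow> to_torus (path_from c u 0)"
    using X by (intro continuous_on_tendsto_compose[where f="\<lambda>t. to_torus (path_from c u t)" and s="{0..1}"]) auto
  then have "(\<lambda>n. \<Psi> (X n)) \<longlonglongrightarrow> to_torus c"
    using X c \<Psi>\<phi> by (simp add: path_from_0)
  then have cx: "to_torus c = to_torus x" using l1 by (intro tendsto_to_torus_unique) auto
  have "\<Psi> t = to_torus (path_from x u t)" if "0 \<le> t" for t
  proof (cases "t = 0")
    case False
    then have "\<Psi> t = to_torus (c + path_from 0 u t)" using that \<Psi>\<phi>[of t] c[of t] path_from_add[of c u t] by simp
    also have "\<dots> = to_torus (x + path_from 0 u t)" by (rule to_torus_add_cong[OF cx])
    finally show ?thesis by (simp flip: path_from_add)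
  qed (simp add: \<Psi>0 path_from_0)
  then show ?thesis using that[OF u _ _ act] Qi by (simp add: set_integrable_def)
qed

text \<open>\<open>velocity\<close> is whatever weak derivative the choice operator returns. It is
  one because u is one, and it agrees with u almost everywhere on positive times, which is enough
  for the integrals. The kinetic term is restricted to positive times since u is arbitrary at
  negative ones.\<close>

lemma path_from_admissible:
  fixes u :: "real \<Rightarrow> real ^ 'n::finite"
  assumes u: "square_integrable u"
    and \<Phi>: "\<And>t. 0 \<le> t \<Longrightarrow> \<Phi> t = to_torus (path_from x u t)"
    and Q: "set_integrable lborel {0<..} (\<lambda>t. Q (\<Phi> t))"
  shows "\<Phi> \<in> admissible Q (to_torus x)"
    and "action Q \<Phi> = 1/2 * (LINT t:{0<..}|lborel. (norm (u t))\<^sup>2) + (LINT t:{0<..}|lborel. Q (\<Phi> t))"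
proof -
  have J: "open {0::real<..}" "is_interval {0::real<..}" by (auto simp: is_interval_1)
  have [measurable]: "u \<in> borel_measurable borel" and u2: "integrable lborel (\<lambda>t. (norm (u t))\<^sup>2)"
    using u by (auto simp: square_integrable_def)
  have u2A: "set_integrable lborel A (\<lambda>t. (norm (u t))\<^sup>2)" if "A \<in> sets borel" for A
    unfolding set_integrable_def using u2 that by (intro integrable_mult_indicator) auto
  have twd: "torus_weak_deriv \<Phi> u I" if "open I" "is_interval I" "I \<subseteq> {0<..}" for I
    unfolding torus_weak_deriv_iff_primitive_on[OF that(1,2)]
    using primitive_on_subset[OF path_from_primitive[OF u], of I x] that(3) \<Phi> by (force simp: subset_iff)
  have "torus_weak_deriv \<Phi> (velocity \<Phi>) {0<..}"
    unfolding velocity_def using twd[OF J order_refl] by (rule someI[of "\<lambda>v. torus_weak_deriv \<Phi> v {0<..}"])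
  from torus_weak_deriv_unique[OF J twd[OF J] this]
  have AE: "AE t in lborel. t \<in> {0<..} \<longrightarrow> u t = velocity \<Phi> t" by simp
  \<comment> \<open>Agreement with u almost everywhere does not give Borel measurability; that comes
    from the chosen velocity being itself the integrand of a primitive.\<close>
  obtain \<phi> where "primitive_on \<phi> (velocity \<Phi>) {0<..}"
    using \<open>torus_weak_deriv \<Phi> (velocity \<Phi>) {0<..}\<close> unfolding torus_weak_deriv_iff_primitive_on[OF J] by auto
  note vm [measurable] = primitive_on_measurable[OF this]
  have L: "set_integrable lborel {0<..} (\<lambda>t. 1/2 * (norm (u t))\<^sup>2 + Q (\<Phi> t))"
    by (intro set_integral_add Q set_integrable_mult_right u2A) auto
  have AEL: "AE t in lborel. indicator {0<..} t *\<^sub>R (1/2 * (norm (u t))\<^sup>2 + Q (\<Phi> t)) = indicator {0<..} t *\<^sub>R lagrangian Q \<Phi> t"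
    using AE by eventually_elim (auto simp: lagrangian_def indicator_def)
  have Qm [measurable]: "(\<lambda>t. indicator {0<..} t *\<^sub>R Q (\<Phi> t)) \<in> borel_measurable borel"
    using Q by (auto simp: set_integrable_def)
  have Lm: "(\<lambda>t. indicator {0<..} t *\<^sub>R lagrangian Q \<Phi> t) \<in> borel_measurable lborel"
  proof -
    have "(\<lambda>t. indicator {0<..} t *\<^sub>R lagrangian Q \<Phi> t) =
      (\<lambda>t. 1/2 * (norm (indicator {0<..} t *\<^sub>R velocity \<Phi> t))\<^sup>2 + indicator {0<..} t *\<^sub>R Q (\<Phi> t))"
      by (auto simp: fun_eq_iff lagrangian_def indicator_def)
    also have "\<dots> \<in> borel_measurable lborel" by measurable
    finally show ?thesis .
  qed
  have Li: "set_integrable lborel {0<..} (lagrangian Q \<Phi>)"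
    using integrable_cong_AE_imp[OF L[unfolded set_integrable_def] Lm AEL] by (simp add: set_integrable_def)
  have "action Q \<Phi> = (LINT t:{0<..}|lborel. 1/2 * (norm (u t))\<^sup>2 + Q (\<Phi> t))"
    unfolding action_def set_lebesgue_integral_def
    using L AEL Lm by (intro integral_cong_AE) (auto simp: set_integrable_def elim!: eventually_mono)
  also have "\<dots> = (LINT t:{0<..}|lborel. 1/2 * (norm (u t))\<^sup>2) + (LINT t:{0<..}|lborel. Q (\<Phi> t))"
    by (intro set_integral_add(2) Q set_integrable_mult_right u2A) auto
  finally show "action Q \<Phi> = 1/2 * (LINT t:{0<..}|lborel. (norm (u t))\<^sup>2) + (LINT t:{0<..}|lborel. Q (\<Phi> t))"
    by simp
  have "\<Phi> \<in> H1 T" for T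
    unfolding H1_def
  proof safe
    have "continuous_on {0..T} (\<lambda>t. to_torus (path_from x u t))"
      by (rule continuous_on_compose2[OF continuous_on_to_torus path_from_continuous[OF u]]) auto
    then show "continuous_on {0..T} \<Phi>" by (rule continuous_on_cong[THEN iffD1, rotated -1]) (simp_all add: \<Phi>)
    have "u \<in> L2 {0<..<T}" using u2A by (simp add: L2_def set_borel_measurable_def)
    moreover have "torus_weak_deriv \<Phi> u {0<..<T}" by (intro twd) (auto simp: is_interval_oo)
    ultimately show "\<exists>v\<in>L2 {0<..<T}. torus_weak_deriv \<Phi> v {0<..<T}" by blast
  qed
  then show "\<Phi> \<in> admissible Q (to_torus x)"
    using Li \<Phi>[of 0] by (simp add: admissible_def H1_loc_def path_from_0)
qed

section \<open>Weak limits of square integrable functions\<close>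

lemma Cauchy_Schwarz_integral:
  fixes f g :: "'a \<Rightarrow> real"
  assumes [measurable]: "f \<in> borel_measurable M" "g \<in> borel_measurable M"
    and f: "integrable M (\<lambda>x. (f x)\<^sup>2)" and g: "integrable M (\<lambda>x. (g x)\<^sup>2)"
  shows "integrable M (\<lambda>x. f x * g x)"
    and "(LINT x|M. f x * g x)\<^sup>2 \<le> (LINT x|M. (f x)\<^sup>2) * (LINT x|M. (g x)\<^sup>2)"
proof -
  show i: "integrable M (\<lambda>x. f x * g x)"
  proof (rule Bochner_Integration.integrable_bound)
    show "integrable M (\<lambda>x. (f x)\<^sup>2 + (g x)\<^sup>2)" using f g by simp
    show "AE x in M. norm (f x * g x) \<le> norm ((f x)\<^sup>2 + (g x)\<^sup>2)"
    proof (rule AE_I2)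
      fix x
      have "2 * \<bar>f x\<bar> * \<bar>g x\<bar> \<le> \<bar>f x\<bar>\<^sup>2 + \<bar>g x\<bar>\<^sup>2" by (rule sum_squares_bound)
      moreover have "0 \<le> \<bar>f x\<bar> * \<bar>g x\<bar>" by simp
      ultimately have "\<bar>f x\<bar> * \<bar>g x\<bar> \<le> \<bar>f x\<bar>\<^sup>2 + \<bar>g x\<bar>\<^sup>2" by linarith
      then show "norm (f x * g x) \<le> norm ((f x)\<^sup>2 + (g x)\<^sup>2)" by (simp add: abs_mult)
    qed
  qed measurable
  define A B C where "A = (LINT x|M. (f x)\<^sup>2)" and "B = (LINT x|M. f x * g x)" and "C = (LINT x|M. (g x)\<^sup>2)"
  \<comment> \<open>The integral of the square of f - K g, as a quadratic in K; its minimum for C >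
    0 is at K = B / C.\<close>
  have q: "0 \<le> A - 2 * K * B + K\<^sup>2 * C" for K
  proof -
    have "0 \<le> (LINT x|M. (f x - K * g x)\<^sup>2)" by (rule integral_nonneg_AE) simp
    also have "\<dots> = (LINT x|M. (f x)\<^sup>2 - 2 * K * (f x * g x) + K\<^sup>2 * (g x)\<^sup>2)"
      by (simp add: power2_eq_square algebra_simps)
    also have "\<dots> = A - 2 * K * B + K\<^sup>2 * C" using f g i by (simp add: A_def B_def C_def)
    finally show ?thesis .
  qed
  have "B\<^sup>2 \<le> A * C"
  proof (cases "C = 0")
    case True
    have "B = 0"
    proof (rule ccontr)
      assume "B \<noteq> 0"
      \<comment> \<open>With C = 0 the bound is linear in K, and this K makes it equal to
        -1.\<close>
      then show False using q[of "(A + 1) / (2 * B)"] True by simp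
    qed
    then show ?thesis using True by simp
  next
    case False
    moreover have "0 \<le> C" unfolding C_def by (rule integral_nonneg_AE) simp
    ultimately have C: "0 < C" by simp
    have "0 \<le> C * (A - 2 * (B / C) * B + (B / C)\<^sup>2 * C)" using q[of "B / C"] C by (intro mult_nonneg_nonneg) auto
    also have "\<dots> = A * C - B\<^sup>2" using C by (simp add: field_simps power2_eq_square)
    finally show ?thesis by simp
  qed
  then show "(LINT x|M. f x * g x)\<^sup>2 \<le> (LINT x|M. (f x)\<^sup>2) * (LINT x|M. (g x)\<^sup>2)"
    by (simp add: A_def B_def C_def)
qed

text \<open>Only the upper bounds \<open>c n\<close> have to converge, not the integrals themselves;
  this covers almost minimal values as well as a constant bound. Integrability of the limit follows
  from finiteness of its nonnegative integral.\<close>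

lemma Fatou_real:
  fixes h :: "nat \<Rightarrow> 'a \<Rightarrow> real"
  assumes h: "\<And>n. integrable M (h n)" "\<And>n x. 0 \<le> h n x" and g [measurable]: "g \<in> borel_measurable M"
    and lim: "AE x in M. (\<lambda>n. h n x) \<longlonglongrightarrow> g x" and c: "\<And>n. (LINT x|M. h n x) \<le> c n" "c \<longlonglongrightarrow> c'"
  shows "integrable M g" "(LINT x|M. g x) \<le> c'"
proof -
  have [measurable]: "h n \<in> borel_measurable M" for n using h by auto
  have nn: "AE x in M. 0 \<le> g x"
    using lim by eventually_elim (auto intro: LIMSEQ_le_const h(2))
  have c0: "0 \<le> c n" for n
    using order_trans[OF Bochner_Integration.integral_nonneg c(1)] h(2) by blast
  have c'0: "0 \<le> c'" using c(2) c0 by (auto intro: LIMSEQ_le_const)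
  have "(\<integral>\<^sup>+x. ennreal (g x) \<partial>M) = (\<integral>\<^sup>+x. liminf (\<lambda>n. ennreal (h n x)) \<partial>M)"
    using lim by (intro nn_integral_cong_AE)
      (auto elim!: eventually_mono intro!: lim_imp_Liminf[symmetric] tendsto_ennrealI)
  also have "\<dots> \<le> liminf (\<lambda>n. \<integral>\<^sup>+x. ennreal (h n x) \<partial>M)"
    by (intro nn_integral_liminf) measurable
  also have "\<dots> \<le> liminf (\<lambda>n. ennreal (c n))"
  proof (intro Liminf_mono always_eventually allI)
    fix n show "(\<integral>\<^sup>+x. ennreal (h n x) \<partial>M) \<le> ennreal (c n)"
      using h c(1)[of n] by (subst nn_integral_eq_integral) (auto intro: ennreal_leI)
  qed
  also have "\<dots> = ennreal c'" using c(2) by (intro lim_imp_Liminf tendsto_ennrealI) auto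
  finally have le: "(\<integral>\<^sup>+x. ennreal (g x) \<partial>M) \<le> ennreal c'" .
  then show i: "integrable M g"
    by (intro integrableI_nonneg g nn) (auto simp: less_top[symmetric] top_unique)
  show "(LINT x|M. g x) \<le> c'"
    using le nn_integral_eq_integral[OF i nn] c'0 by simp
qed

section \<open>Geometry of square integrable functions\<close>

lemma parallelogram_law:
  fixes x y :: "'a::real_inner"
  shows "(norm (x + y))\<^sup>2 + (norm (x - y))\<^sup>2 = 2 * (norm x)\<^sup>2 + 2 * (norm y)\<^sup>2"
  by (simp add: power2_norm_eq_inner inner_simps inner_commute)

lemma square_integrable_add:
  assumes "square_integrable u" "square_integrable v"
  shows "square_integrable (\<lambda>t. u t + v t)"
  unfolding square_integrable_def
proof
  have [measurable]: "u \<in> borel_measurable borel" "v \<in> borel_measurable borel"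
    and i: "integrable lborel (\<lambda>t. 2 * (norm (u t))\<^sup>2 + 2 * (norm (v t))\<^sup>2)"
    using assms by (auto simp: square_integrable_def)
  show "(\<lambda>t. u t + v t) \<in> borel_measurable borel" by measurable
  show "integrable lborel (\<lambda>t. (norm (u t + v t))\<^sup>2)"
  proof (rule Bochner_Integration.integrable_bound[OF i])
    have "(norm (u t + v t))\<^sup>2 \<le> 2 * (norm (u t))\<^sup>2 + 2 * (norm (v t))\<^sup>2" for t
      using parallelogram_law[of "u t" "v t"] zero_le_power2[of "norm (u t - v t)"] by linarith
    then show "AE t in lborel. norm ((norm (u t + v t))\<^sup>2) \<le> norm (2 * (norm (u t))\<^sup>2 + 2 * (norm (v t))\<^sup>2)"
      by (intro AE_I2) simp
  qed measurable
qed

lemma square_integrable_scaleR: "square_integrable u \<Longrightarrow> square_integrable (\<lambda>t. c *\<^sub>R u t)"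
  by (auto simp: square_integrable_def power_mult_distrib)

lemma square_integrable_diff:
  assumes "square_integrable u" "square_integrable v"
  shows "square_integrable (\<lambda>t. u t - v t)"
  using square_integrable_add[OF assms(1) square_integrable_scaleR[OF assms(2), of "-1"]] by simp

text \<open>Cauchy-Schwarz against the indicator of \<open>{a..b}\<close>. It is the source of the
  Hoelder estimate for paths, and it makes integrals over bounded intervals continuous in the L2
  norm.\<close>

lemma norm_integral_Icc_square_le:
  assumes u: "square_integrable u" and ab: "a \<le> b"
  shows "(norm (LINT t:{a..b}|lborel. u t))\<^sup>2 \<le> (b - a) * (LINT t|lborel. (norm (u t))\<^sup>2)"
proof -
  have [measurable]: "u \<in> borel_measurable borel" and u2: "integrable lborel (\<lambda>t. (norm (u t))\<^sup>2)"
    using u by (auto simp: square_integrable_def)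
  have ind: "(indicator {a..b} t :: real)\<^sup>2 = indicator {a..b} t" for t by (simp add: indicator_def)
  have i1: "integrable lborel (\<lambda>t. (indicator {a..b} t :: real)\<^sup>2)"
    unfolding ind by (simp add: emeasure_lborel_Icc_eq)
  have "norm (LINT t:{a..b}|lborel. u t) \<le> (LINT t|lborel. norm (indicator {a..b} t *\<^sub>R u t))"
    unfolding set_lebesgue_integral_def by (rule integral_norm_bound)
  then have "norm (LINT t:{a..b}|lborel. u t) \<le> (LINT t|lborel. indicator {a..b} t * norm (u t))"
    by simp
  then have "(norm (LINT t:{a..b}|lborel. u t))\<^sup>2 \<le> (LINT t|lborel. indicator {a..b} t * norm (u t))\<^sup>2"
    by (intro power_mono) auto
  also have "\<dots> \<le> (LINT t|lborel. (indicator {a..b} t :: real)\<^sup>2) * (LINT t|lborel. (norm (u t))\<^sup>2)"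
    by (rule Cauchy_Schwarz_integral(2)[OF _ _ i1 u2]) measurable
  also have "(LINT t|lborel. (indicator {a..b} t :: real)\<^sup>2) = b - a"
    unfolding ind using ab by simp
  finally show ?thesis .
qed

text \<open>On the infinite line L2 is not contained in L1, where the subsequence theorem applies. A
  positive weight p that is both integrable and square integrable turns the sequence into an
  L1-Cauchy one by Cauchy-Schwarz, and positivity of p allows division by it afterwards.\<close>

lemma square_integrable_Cauchy_AE_subseq:
  fixes u :: "nat \<Rightarrow> real \<Rightarrow> real ^ 'n"
  assumes u: "\<And>n. square_integrable (u n)"
    and C: "\<And>e. e > 0 \<Longrightarrow> \<exists>N. \<forall>i\<ge>N. \<forall>j\<ge>N. (LINT t|lborel. (norm (u i t - u j t))\<^sup>2) < e"
  obtains r v where "strict_mono r" "v \<in> borel_measurable borel" "AE t in lborel. (\<lambda>i. u (r i) t) \<longlonglongrightarrow> v t"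
proof -
  obtain p :: "real \<Rightarrow> real" where p [measurable]: "p \<in> borel_measurable lborel" and p01: "\<And>t. 0 < p t" "\<And>t. p t \<le> 1"
    and pi: "integrable lborel p"
    using sigma_finite_measure.obtain_positive_integrable_function[OF lborel.sigma_finite_measure_axioms] by blast
  have p2: "integrable lborel (\<lambda>t. (p t)\<^sup>2)"
  proof (rule Bochner_Integration.integrable_bound[OF pi])
    show "AE t in lborel. norm ((p t)\<^sup>2) \<le> norm (p t)"
      using p01 by (intro AE_I2) (simp add: power2_eq_square less_imp_le mult_left_le)
  qed measurable
  have um [measurable]: "u n \<in> borel_measurable borel" for n using u by (auto simp: square_integrable_def)
  have pu: "integrable lborel (\<lambda>t. p t *\<^sub>R w t)"
    and le: "(LINT t|lborel. norm (p t *\<^sub>R w t))\<^sup>2 \<le> (LINT t|lborel. (p t)\<^sup>2) * (LINT t|lborel. (norm (w t))\<^sup>2)"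
    if w: "square_integrable w" for w :: "real \<Rightarrow> real ^ 'n"
  proof -
    have [measurable]: "w \<in> borel_measurable borel" and w2: "integrable lborel (\<lambda>t. (norm (w t))\<^sup>2)"
      using w by (auto simp: square_integrable_def)
    note CS = Cauchy_Schwarz_integral[of p lborel "\<lambda>t. norm (w t)", OF _ _ p2 w2]
    have eq: "norm (p t *\<^sub>R w t) = p t * norm (w t)" for t using p01(1)[of t] by simp
    have "integrable lborel (\<lambda>t. norm (p t *\<^sub>R w t))" unfolding eq by (rule CS(1)) measurable
    then show "integrable lborel (\<lambda>t. p t *\<^sub>R w t)" by (subst (asm) integrable_norm_iff) measurable
    show "(LINT t|lborel. norm (p t *\<^sub>R w t))\<^sup>2 \<le> (LINT t|lborel. (p t)\<^sup>2) * (LINT t|lborel. (norm (w t))\<^sup>2)"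
      unfolding eq by (rule CS(2)) measurable
  qed
  define P where "P = (LINT t|lborel. (p t)\<^sup>2) + 1"
  have "0 \<le> (LINT t|lborel. (p t)\<^sup>2)" by (rule Bochner_Integration.integral_nonneg) simp
  then have P: "0 < P" "(LINT t|lborel. (p t)\<^sup>2) \<le> P" unfolding P_def by linarith+
  obtain r where r: "strict_mono r" and Cau: "AE t in lborel. Cauchy (\<lambda>i. p t *\<^sub>R u (r i) t)"
  proof (rule cauchy_L1_AE_cauchy_subseq[of lborel "\<lambda>n t. p t *\<^sub>R u n t"])
    show "integrable lborel (\<lambda>t. p t *\<^sub>R u n t)" for n by (rule pu[OF u])
    fix e :: real assume e: "e > 0"
    obtain N where N: "\<And>i j. i \<ge> N \<Longrightarrow> j \<ge> N \<Longrightarrow> (LINT t|lborel. (norm (u i t - u j t))\<^sup>2) < e\<^sup>2 / P"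
      using C[of "e\<^sup>2 / P"] e P by auto
    have "(LINT t|lborel. norm (p t *\<^sub>R u i t - p t *\<^sub>R u j t)) < e" if "i \<ge> N" "j \<ge> N" for i j
    proof -
      have "(LINT t|lborel. norm (p t *\<^sub>R (u i t - u j t)))\<^sup>2 \<le> (LINT t|lborel. (p t)\<^sup>2) * (LINT t|lborel. (norm (u i t - u j t))\<^sup>2)"
        by (rule le[OF square_integrable_diff[OF u u]])
      also have "\<dots> \<le> P * (LINT t|lborel. (norm (u i t - u j t))\<^sup>2)"
        by (intro mult_right_mono P) simp
      also have "\<dots> < P * (e\<^sup>2 / P)" using N[OF that] P by (intro mult_strict_left_mono) auto
      also have "\<dots> = e\<^sup>2" using P by simp
      finally have "(LINT t|lborel. norm (p t *\<^sub>R (u i t - u j t)))\<^sup>2 < e\<^sup>2" .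
      then have "(LINT t|lborel. norm (p t *\<^sub>R (u i t - u j t))) < e"
        using e by (intro power_less_imp_less_base[of _ 2 e]) auto
      then show ?thesis by (simp only: scaleR_diff_right)
    qed
    then show "\<exists>N. \<forall>i\<ge>N. \<forall>j\<ge>N. (LINT t|lborel. norm (p t *\<^sub>R u i t - p t *\<^sub>R u j t)) < e" by blast
  qed
  define v where "v t = lim (\<lambda>i. u (r i) t)" for t
  have "v \<in> borel_measurable borel" unfolding v_def by measurable
  moreover have "AE t in lborel. (\<lambda>i. u (r i) t) \<longlonglongrightarrow> v t"
    using Cau
  proof eventually_elim
    case (elim t)
    then have "convergent (\<lambda>i. p t *\<^sub>R u (r i) t)" by (simp add: Cauchy_convergent_iff)
    then obtain l where "(\<lambda>i. p t *\<^sub>R u (r i) t) \<longlonglongrightarrow> l" by (auto simp: convergent_def)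
    then have "(\<lambda>i. inverse (p t) *\<^sub>R p t *\<^sub>R u (r i) t) \<longlonglongrightarrow> inverse (p t) *\<^sub>R l" by (intro tendsto_intros)
    then have "convergent (\<lambda>i. u (r i) t)" using p01(1)[of t] by (auto simp: convergent_def)
    then show ?case unfolding v_def by (simp add: convergent_LIMSEQ_iff)
  qed
  ultimately show ?thesis using that r by blast
qed

text \<open>Rather than extracting a weakly convergent subsequence, take almost minimal elements of a decreasing
  sequence of convex sets containing the tails of \<open>w\<close>: by the parallelogram law they are Cauchy in norm.\<close>

lemma square_integrable_weak_limit:
  fixes w :: "nat \<Rightarrow> real \<Rightarrow> real ^ 'n"
  assumes w: "\<And>i. square_integrable (w i)" and S: "S \<subseteq> {0..}"
    and \<phi>: "\<And>t. t \<in> S \<Longrightarrow> (\<lambda>i. LINT s:{0..t}|lborel. w i s) \<longlonglongrightarrow> \<phi> t"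
    and A: "(\<lambda>i. LINT t|lborel. (norm (w i t))\<^sup>2) \<longlonglongrightarrow> A"
  obtains v where "square_integrable v" "(LINT t|lborel. (norm (v t))\<^sup>2) \<le> A"
    "\<And>t. t \<in> S \<Longrightarrow> (LINT s:{0..t}|lborel. v s) = \<phi> t"
proof -
  define I where "I u t = (LINT s:{0..t}|lborel. u s)" for u :: "real \<Rightarrow> real ^ 'n" and t :: real
  define N where "N u = (LINT t|lborel. (norm (u t))\<^sup>2)" for u :: "real \<Rightarrow> real ^ 'n"
  \<comment> \<open>Membership means: for t in S, every closed ball around \<open>\<phi> t\<close>
    that contains the integrals of all \<open>w i\<close> with i \<ge> m also contains that of u.
    Convexity of balls makes \<open>C m\<close> convex, and picking one element from each
    \<open>C m\<close> gives integrals that still tend to \<open>\<phi> t\<close>.\<close>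
  define C where "C m = {u. square_integrable u \<and> (\<forall>t\<in>S. \<forall>e. (\<forall>i\<ge>m. norm (I (w i) t - \<phi> t) \<le> e) \<longrightarrow> norm (I u t - \<phi> t) \<le> e)}" for m
  have N0: "0 \<le> N u" for u unfolding N_def by (rule Bochner_Integration.integral_nonneg) simp
  have Ni: "integrable lborel (\<lambda>t. (norm (u t))\<^sup>2)" if "square_integrable u" for u :: "real \<Rightarrow> real ^ 'n"
    using that by (simp add: square_integrable_def)
  have bdd: "bdd_below (N ` C m)" for m by (rule bdd_belowI[of _ 0]) (auto simp: N0)
  have wC: "w i \<in> C m" if "m \<le> i" for i m using that w by (auto simp: C_def)
  have Cmono: "C n \<subseteq> C m" if "m \<le> n" for m n using that by (auto simp: C_def)
  \<comment> \<open>The infimum grows with m because the sets shrink, and it stays below A because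
    \<open>C m\<close> contains all later \<open>w i\<close>, whose squared norms tend to A.\<close>
  define d where "d m = (INF u\<in>C m. N u)" for m
  have dle: "d m \<le> N u" if "u \<in> C m" for m u unfolding d_def using bdd that by (rule cINF_lower)
  have "d m \<le> d n" if "m \<le> n" for m n
    unfolding d_def[of n] using wC[OF order_refl, of n] dle Cmono[OF that] by (intro cINF_greatest) blast+
  then have "incseq d" by (simp add: incseq_def)
  moreover have dA: "d m \<le> A" for m
    using A dle[OF wC] unfolding N_def by (intro LIMSEQ_le_const[of _ A]) blast+
  ultimately obtain D where D: "d \<longlonglongrightarrow> D" "\<And>m. d m \<le> D"
    using incseq_convergent[of d A] by metis
  have DA: "D \<le> A" using LIMSEQ_le_const2[OF D(1)] dA by blast
  have "\<exists>u\<in>C m. N u < d m + 1 / real (Suc m)" for m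
    using cInf_lessD[of "N ` C m" "d m + 1 / real (Suc m)"] wC[OF order_refl] by (auto simp: d_def)
  then obtain u where uC: "\<And>m. u m \<in> C m" and uN: "\<And>m. N (u m) < d m + 1 / real (Suc m)" by metis
  have u: "square_integrable (u m)" for m using uC by (auto simp: C_def)
  \<comment> \<open>What the parallelogram law leaves for m \<le> n: the two squared norms exceed
    \<open>d m\<close> and \<open>d n \<le> D\<close> by at most the error of index m, while the
    midpoint, lying in \<open>C m\<close>, has squared norm at least \<open>d m\<close>.\<close>
  define \<epsilon> where "\<epsilon> m = 2 * (D - d m) + 4 * (1 / real (Suc m))" for m
  have "\<epsilon> \<longlonglongrightarrow> 2 * (D - D) + 4 * 0" unfolding \<epsilon>_def
    by (intro tendsto_intros D LIMSEQ_Suc[OF lim_1_over_n])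
  then have \<epsilon>: "\<epsilon> \<longlonglongrightarrow> 0" by simp
  have close: "N (\<lambda>t. u m t - u n t) \<le> \<epsilon> m" if mn: "m \<le> n" for m n
  proof -
    have un: "u n \<in> C m" using uC Cmono[OF mn] by blast
    define h where "h t = (1/2) *\<^sub>R (u m t + u n t)" for t
    have h: "square_integrable h" unfolding h_def by (intro square_integrable_scaleR square_integrable_add u)
    have Ih: "I h t = (1/2) *\<^sub>R (I (u m) t + I (u n) t)" for t
      unfolding I_def h_def using square_integrable_set_integrable[OF u] by simp
    have "h \<in> C m" unfolding C_def
    proof (intro CollectI conjI h ballI allI impI)
      fix t e assume t: "t \<in> S" "\<forall>i\<ge>m. norm (I (w i) t - \<phi> t) \<le> e"
      then have e: "norm (I (u m) t - \<phi> t) \<le> e" "norm (I (u n) t - \<phi> t) \<le> e"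
        using uC[of m] un by (auto simp: C_def)
      have "I h t - \<phi> t = (1/2) *\<^sub>R ((I (u m) t - \<phi> t) + (I (u n) t - \<phi> t))"
        by (simp add: Ih vec_eq_iff field_simps)
      also have "norm \<dots> \<le> (1/2) * (e + e)"
        unfolding norm_scaleR using norm_triangle_mono[OF e] by simp
      finally show "norm (I h t - \<phi> t) \<le> e" by simp
    qed
    then have dh: "d m \<le> N h" by (rule dle)
    have "N (\<lambda>t. u m t - u n t) = (LINT t|lborel. 2 * (norm (u m t))\<^sup>2 + 2 * (norm (u n t))\<^sup>2 - 4 * (norm (h t))\<^sup>2)"
      unfolding N_def
    proof (intro Bochner_Integration.integral_cong refl)
      fix t
      show "(norm (u m t - u n t))\<^sup>2 = 2 * (norm (u m t))\<^sup>2 + 2 * (norm (u n t))\<^sup>2 - 4 * (norm (h t))\<^sup>2"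
        using parallelogram_law[of "u m t" "u n t"] by (simp add: h_def power_mult_distrib power_divide)
    qed
    also have "\<dots> = 2 * N (u m) + 2 * N (u n) - 4 * N h"
      using Ni[OF u] Ni[OF h] by (simp add: N_def)
    also have "\<dots> \<le> \<epsilon> m"
    proof -
      have "1 / real (Suc n) \<le> 1 / real (Suc m)" using mn by (simp add: frac_le)
      moreover have "2 * x + 2 * y - 4 * z \<le> 2 * (D' - a) + 4 * p"
        if "q \<le> p" "x < a + p" "y < b + q" "b \<le> D'" "a \<le> z" for x y z a b p q D' :: real
        using that by argo
      ultimately show ?thesis using uN[of m] uN[of n] D(2)[of n] dh unfolding \<epsilon>_def by blast
    qed
    finally show ?thesis .
  qed
  have sym: "N (\<lambda>t. u m t - u n t) = N (\<lambda>t. u n t - u m t)" for m n by (simp add: N_def norm_minus_commute)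
  obtain r v where r: "strict_mono r" and v [measurable]: "v \<in> borel_measurable borel"
    and lim: "AE t in lborel. (\<lambda>i. u (r i) t) \<longlonglongrightarrow> v t"
  proof (rule square_integrable_Cauchy_AE_subseq[OF u])
    fix e :: real assume "e > 0"
    then obtain M where M: "\<And>m. m \<ge> M \<Longrightarrow> \<epsilon> m < e"
      using order_tendstoD(2)[OF \<epsilon>] by (auto simp: eventually_sequentially)
    have "N (\<lambda>t. u i t - u j t) < e" if "i \<ge> M" "j \<ge> M" for i j
    proof (cases "i \<le> j")
      case True
      then show ?thesis using close[OF True] M[OF that(1)] by simp
    next
      case False
      then show ?thesis using close[of j i] sym[of i j] M[OF that(2)] by simp
    qed
    then show "\<exists>M. \<forall>i\<ge>M. \<forall>j\<ge>M. (LINT t|lborel. (norm (u i t - u j t))\<^sup>2) < e" unfolding N_def by blast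
  qed
  have c: "(\<lambda>i. d (r i) + 1 / real (Suc (r i))) \<longlonglongrightarrow> D + 0"
    using LIMSEQ_subseq_LIMSEQ[OF D(1) r] LIMSEQ_subseq_LIMSEQ[OF LIMSEQ_Suc[OF lim_1_over_n] r]
    by (intro tendsto_add) (simp_all add: comp_def)
  have "AE t in lborel. (\<lambda>i. (norm (u (r i) t))\<^sup>2) \<longlonglongrightarrow> (norm (v t))\<^sup>2"
    using lim by eventually_elim (intro tendsto_intros)
  note Fat = Fatou_real[OF Ni[OF u] zero_le_power2 _ this less_imp_le[OF uN[unfolded N_def]] c]
  have Fat: "integrable lborel (\<lambda>t. (norm (v t))\<^sup>2)" "N v \<le> D + 0"
    using Fat unfolding N_def by simp_all
  have vs: "square_integrable v" using Fat(1) v by (simp add: square_integrable_def)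
  have Nd: "N (\<lambda>t. u (r i) t - v t) \<le> \<epsilon> (r i)" for i
  proof -
    \<comment> \<open>Bounding the second index below by i makes the estimate valid for every j
      without changing the limit in j.\<close>
    have le: "N (\<lambda>t. u (r i) t - u (r (max i j)) t) \<le> \<epsilon> (r i)" for j
      using r by (intro close) (simp add: strict_mono_less_eq)
    have AE: "AE t in lborel. (\<lambda>j. (norm (u (r i) t - u (r (max i j)) t))\<^sup>2) \<longlonglongrightarrow> (norm (u (r i) t - v t))\<^sup>2"
      using lim
    proof eventually_elim
      case (elim t)
      have "(\<lambda>j. u (r (max i j)) t) \<longlonglongrightarrow> v t"
        by (rule Lim_transform_eventually[OF elim])
           (auto simp: eventually_sequentially max_def intro!: exI[of _ i])
      then show ?case by (intro tendsto_intros)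
    qed
    have meas: "(\<lambda>t. (norm (u (r i) t - v t))\<^sup>2) \<in> borel_measurable lborel"
      by (rule borel_measurable_integrable[OF Ni[OF square_integrable_diff[OF u vs]]])
    show ?thesis unfolding N_def
      by (rule Fatou_real(2)[OF Ni[OF square_integrable_diff[OF u u]] zero_le_power2 meas AE le[unfolded N_def] tendsto_const])
  qed
  have "I v t = \<phi> t" if t: "t \<in> S" for t
  proof -
    have t0: "0 \<le> t" using t S by auto
    have "(\<lambda>m. I (u m) t) \<longlonglongrightarrow> \<phi> t"
    proof (rule LIMSEQ_I)
      fix e :: real assume e: "e > 0"
      then obtain M where M: "\<And>i. i \<ge> M \<Longrightarrow> norm (I (w i) t - \<phi> t) < e / 2"
        using LIMSEQ_D[OF \<phi>[OF t], of "e/2"] unfolding I_def by auto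
      have "norm (I (u m) t - \<phi> t) < e" if "m \<ge> M" for m
      proof -
        have "\<forall>i\<ge>m. norm (I (w i) t - \<phi> t) \<le> e / 2" using M that by (meson le_trans less_imp_le)
        then have "norm (I (u m) t - \<phi> t) \<le> e / 2" using uC[of m] t unfolding C_def by blast
        then show ?thesis using e by simp
      qed
      then show "\<exists>M. \<forall>m\<ge>M. norm (I (u m) t - \<phi> t) < e" by blast
    qed
    from LIMSEQ_subseq_LIMSEQ[OF this r] have l1: "(\<lambda>i. I (u (r i)) t) \<longlonglongrightarrow> \<phi> t" by (simp add: comp_def)
    \<comment> \<open>Here the convergence in norm pays off: \<open>Nd\<close> bounds the difference
      of the integrals over \<open>{0..t}\<close>, so v inherits the values of \<phi>.\<close>
    have "(\<lambda>i. I (u (r i)) t - I v t) \<longlonglongrightarrow> 0"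
    proof (rule Lim_null_comparison)
      have "norm (I (u (r i)) t - I v t) \<le> sqrt (t * \<epsilon> (r i))" for i
      proof -
        have "I (u (r i)) t - I v t = I (\<lambda>s. u (r i) s - v s) t"
          unfolding I_def by (rule set_integral_diff(2)[symmetric]; rule square_integrable_set_integrable; fact)
        then have "(norm (I (u (r i)) t - I v t))\<^sup>2 \<le> t * N (\<lambda>s. u (r i) s - v s)"
          using norm_integral_Icc_square_le[OF square_integrable_diff[OF u vs] t0] by (simp add: I_def N_def)
        also have "\<dots> \<le> t * \<epsilon> (r i)" using t0 Nd by (intro mult_left_mono)
        finally show ?thesis by (rule real_le_rsqrt)
      qed
      then show "eventually (\<lambda>i. norm (I (u (r i)) t - I v t) \<le> sqrt (t * \<epsilon> (r i))) sequentially" by simp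
      have "(\<lambda>i. sqrt (t * (\<epsilon> \<circ> r) i)) \<longlonglongrightarrow> sqrt (t * 0)"
        by (intro tendsto_intros LIMSEQ_subseq_LIMSEQ[OF \<epsilon> r])
      then show "(\<lambda>i. sqrt (t * \<epsilon> (r i))) \<longlonglongrightarrow> 0" by simp
    qed
    then have "(\<lambda>i. I (u (r i)) t) \<longlonglongrightarrow> I v t" by (simp add: LIM_zero_iff)
    then show ?thesis using l1 LIMSEQ_unique by blast
  qed
  then show ?thesis using that[OF vs] Fat(2) DA by (simp add: I_def N_def)
qed

section \<open>Existence of a minimizer\<close>

text \<open>Shrinking the radius from p to s p multiplies every monomial except the constant one by
  at most s, so \<open>f x - f a\<close> is bounded by s times the sum of absolute values at radius
  p.\<close>

lemma torus_real_analytic_continuous: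
  fixes Q :: "'n::finite torus \<Rightarrow> real"
  assumes "torus_real_analytic Q"
  shows "continuous_on S (\<lambda>x. Q (to_torus x))"
proof -
  define f where "f x = Q (to_torus x)" for x
  have "isCont f a" for a
  proof -
    have "real_analytic f" using assms by (simp add: torus_real_analytic_def f_def[abs_def])
    then obtain r c where r: "r > 0" and f': "\<forall>x. (\<forall>i. \<bar>x $ i - a $ i\<bar> < r) \<longrightarrow>
       ((\<lambda>\<alpha>. c \<alpha> * (\<Prod>i\<in>UNIV. (x $ i - a $ i) ^ \<alpha> i)) has_sum f x) (UNIV :: ('n \<Rightarrow> nat) set)"
      unfolding real_analytic_def by blast
    note f = f'[rule_format]
    \<comment> \<open>The point with all coordinates shifted by p lies inside the region of
      convergence. Summability of a real family is absolute, so the series there yields the majorant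
      b.\<close>
    define p where "p = r / 2"
    have p: "p > 0" "p < r" using r by (auto simp: p_def)
    define b where "b \<alpha> = \<bar>c \<alpha>\<bar> * (\<Prod>i\<in>UNIV. p ^ \<alpha> i)" for \<alpha> :: "'n \<Rightarrow> nat"
    have bnn: "b \<alpha> \<ge> 0" for \<alpha> using p by (auto simp: b_def intro!: mult_nonneg_nonneg prod_nonneg)
    have "((\<lambda>\<alpha>. c \<alpha> * (\<Prod>i\<in>UNIV. p ^ \<alpha> i)) has_sum f (\<chi> i. a $ i + p)) UNIV"
      using f[of "\<chi> i. a $ i + p"] p by simp
    then have "(\<lambda>\<alpha>. c \<alpha> * (\<Prod>i\<in>UNIV. p ^ \<alpha> i)) summable_on UNIV" by (rule has_sum_imp_summable)
    then have "(\<lambda>\<alpha>. norm (c \<alpha> * (\<Prod>i\<in>UNIV. p ^ \<alpha> i))) summable_on UNIV"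
      by (rule summable_on_iff_abs_summable_on_real[THEN iffD1])
    then have bs: "b summable_on UNIV" using p by (simp add: b_def[abs_def] abs_mult abs_prod power_abs)
    define B where "B = infsum b UNIV"
    \<comment> \<open>At the centre every other multi-index contributes a positive power of
      0.\<close>
    have fa: "f a = c (\<lambda>_. 0)"
    proof -
      have "((\<lambda>\<alpha>. c \<alpha> * (\<Prod>i\<in>UNIV. (a $ i - a $ i) ^ \<alpha> i)) has_sum f a) UNIV"
        using r by (intro f) simp
      moreover have "c \<alpha> * (\<Prod>i\<in>UNIV. (a $ i - a $ i) ^ \<alpha> i) = (if \<alpha> = (\<lambda>_. 0) then c (\<lambda>_. 0) else 0)" for \<alpha> :: "'n \<Rightarrow> nat"
      proof (cases "\<alpha> = (\<lambda>_. 0)")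
        case False
        then obtain j where "\<alpha> j \<noteq> 0" by (auto simp: fun_eq_iff)
        then show ?thesis using False by (auto simp: power_0_left)
      qed simp
      ultimately have "((\<lambda>\<alpha>. if \<alpha> = (\<lambda>_. 0) then c (\<lambda>_. 0) else 0) has_sum f a) (UNIV :: ('n \<Rightarrow> nat) set)" by simp
      moreover have "((\<lambda>\<alpha>. if \<alpha> = (\<lambda>_. 0) then c (\<lambda>_. 0) else 0) has_sum c (\<lambda>_. 0)) (UNIV :: ('n \<Rightarrow> nat) set)"
        by (rule has_sum_finite_neutralI[of "{\<lambda>_. 0}"]) auto
      ultimately show ?thesis by (rule has_sum_unique)
    qed
    have bound: "\<bar>f x - f a\<bar> \<le> norm (x - a) / p * B" if x: "norm (x - a) < p" for x
    proof -
      define s where "s = norm (x - a) / p"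
      have s: "0 \<le> s" "s < 1" using x p by (auto simp: s_def)
      have xi: "\<bar>x $ i - a $ i\<bar> \<le> s * p" for i
        using component_le_norm_cart[of "x - a" i] p by (simp add: s_def)
      have sp: "s * p < r" using s p by (smt (verit) mult_less_cancel_right1)
      have hs: "((\<lambda>\<alpha>. c \<alpha> * (\<Prod>i\<in>UNIV. (x $ i - a $ i) ^ \<alpha> i)) has_sum f x) UNIV"
        by (intro f le_less_trans[OF xi sp])
      have h0: "((\<lambda>\<alpha>. if \<alpha> = (\<lambda>_. 0) then f a else 0) has_sum f a) (UNIV :: ('n \<Rightarrow> nat) set)"
        by (rule has_sum_finite_neutralI[of "{\<lambda>_. 0}"]) auto
      define d where "d \<alpha> = c \<alpha> * (\<Prod>i\<in>UNIV. (x $ i - a $ i) ^ \<alpha> i) - (if \<alpha> = (\<lambda>_. 0) then f a else 0)" for \<alpha> :: "'n \<Rightarrow> nat"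
      have hd: "(d has_sum (f x - f a)) UNIV"
        unfolding d_def using has_sum_add[OF hs has_sum_uminusI[OF h0]] by simp
      have db: "\<bar>d \<alpha>\<bar> \<le> s * b \<alpha>" for \<alpha>
      proof (cases "\<alpha> = (\<lambda>_. 0)")
        case True
        then show ?thesis using s bnn by (simp add: d_def fa)
      next
        case False
        then obtain j where j: "\<alpha> j \<noteq> 0" by (auto simp: fun_eq_iff)
        have "\<bar>d \<alpha>\<bar> = \<bar>c \<alpha>\<bar> * (\<Prod>i\<in>UNIV. \<bar>x $ i - a $ i\<bar> ^ \<alpha> i)"
          using False by (simp add: d_def abs_mult abs_prod power_abs)
        also have "\<dots> \<le> \<bar>c \<alpha>\<bar> * (\<Prod>i\<in>UNIV. (s * p) ^ \<alpha> i)"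
          using xi by (intro mult_left_mono prod_mono) (auto intro: power_mono)
        also have "\<dots> = (\<Prod>i\<in>UNIV. s ^ \<alpha> i) * b \<alpha>"
          by (simp add: b_def power_mult_distrib prod.distrib)
        also have "\<dots> \<le> s * b \<alpha>"
        proof (intro mult_right_mono bnn)
          have "(\<Prod>i\<in>UNIV. s ^ \<alpha> i) = s ^ (\<Sum>i\<in>UNIV. \<alpha> i)" by (simp add: power_sum)
          also have "\<dots> \<le> s ^ 1"
          proof (rule power_decreasing)
            show "1 \<le> (\<Sum>i\<in>UNIV. \<alpha> i)" using j member_le_sum[of j UNIV \<alpha>] by simp
          qed (use s in auto)
          finally show "(\<Prod>i\<in>UNIV. s ^ \<alpha> i) \<le> s" by simp
        qed
        finally show ?thesis .
      qed
      have sb: "((\<lambda>\<alpha>. s * b \<alpha>) has_sum s * B) UNIV"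
        unfolding B_def by (intro has_sum_cmult_right has_sum_infsum bs)
      have "f x - f a \<le> s * B" by (rule has_sum_mono[OF hd sb]) (use db abs_le_iff in blast)
      moreover have "- (f x - f a) \<le> s * B"
        by (rule has_sum_mono[OF has_sum_uminusI[OF hd] sb]) (use db abs_le_iff in blast)
      ultimately show ?thesis by (simp add: s_def abs_le_iff)
    qed
    show "isCont f a" unfolding isCont_def
    proof (rule LIM_zero_cancel, rule Lim_null_comparison)
      show "eventually (\<lambda>x. norm (f x - f a) \<le> norm (x - a) / p * B) (at a)"
        unfolding eventually_at using p bound by (auto simp: dist_norm intro!: exI[of _ p])
      have "((\<lambda>x. norm (x - a) / p * B) \<longlongrightarrow> norm (a - a) / p * B) (at a)"
        by (intro tendsto_intros) (use p in auto)
      then show "((\<lambda>x. norm (x - a) / p * B) \<longlongrightarrow> 0) (at a)" by simp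
    qed
  qed
  then show ?thesis unfolding f_def by (simp add: continuous_at_imp_continuous_on)
qed

lemma path_from_diff_le:
  assumes u: "square_integrable u" and ab: "0 \<le> a" "a \<le> b"
  shows "(norm (path_from x u b - path_from x u a))\<^sup>2 \<le> (b - a) * (LINT t|lborel. (norm (u t))\<^sup>2)"
  using primitive_onD(2)[OF path_from_primitive[OF u], of a b x] norm_integral_Icc_square_le[OF u ab(2)] ab
  by simp

lemma admissible_nonempty:
  fixes Q :: "'n::finite torus \<Rightarrow> real"
  assumes Q: "continuous_on UNIV (\<lambda>x. Q (to_torus x))" and z: "Q (to_torus z) = 0"
  shows "admissible Q (to_torus x) \<noteq> {}"
proof -
  define u where "u t = indicator {0..1} t *\<^sub>R (z - x)" for t :: real
  have "(\<lambda>t. (norm (u t))\<^sup>2) = (\<lambda>t. indicator {0..1} t * (norm (z - x))\<^sup>2)"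
    by (auto simp: u_def indicator_def fun_eq_iff)
  then have u: "square_integrable u"
    by (simp add: square_integrable_def emeasure_lborel_Icc_eq) (simp add: u_def[abs_def])
  have path: "path_from x u t = z" if "1 \<le> t" for t
  proof -
    have "(LINT s:{0..t}|lborel. u s) = (LINT s|lborel. indicator {0..1::real} s *\<^sub>R (z - x))"
      unfolding set_lebesgue_integral_def u_def using that
      by (intro Bochner_Integration.integral_cong) (auto simp: indicator_def)
    also have "\<dots> = z - x" by (simp add: emeasure_lborel_Icc_eq)
    finally show ?thesis by (simp add: path_from_def)
  qed
  let ?q = "\<lambda>t. Q (to_torus (path_from x u t))"
  have "continuous_on {0..1} ?q"
    by (rule continuous_on_compose2[OF Q path_from_continuous[OF u]]) auto
  then have "set_integrable lborel {0..1} ?q"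
    unfolding set_integrable_def by (intro borel_integrable_compact) auto
  then have "set_integrable lborel {0<..1} ?q" by (rule set_integrable_subset) auto
  moreover have "set_integrable lborel {1<..} ?q"
    using set_integrable_cong[of lborel lborel "{1<..}" "{1<..}" ?q "\<lambda>_. 0"] path z
    by (simp add: set_integrable_def)
  ultimately have "set_integrable lborel ({0<..1} \<union> {1<..}) ?q"
    by (intro set_integrable_Un) auto
  also have "{0<..1} \<union> {1<..} = {0::real<..}" by auto
  finally have "(\<lambda>t. to_torus (path_from x u t)) \<in> admissible Q (to_torus x)"
    by (intro path_from_admissible(1)[OF u refl])
  then show ?thesis by blast
qed

section \<open>The minimizing sequence and its limit\<close>

theorem proposition3:
  fixes Q :: "'n::finite torus \<Rightarrow> real" and \<Phi>\<^sub>0 :: "'n torus"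
  assumes "torus_real_analytic Q"
    and "\<forall>\<theta>. 0 \<le> Q \<theta>"
    and "zero_set Q \<noteq> {}"
  shows "\<exists>\<Phi>\<in>admissible Q \<Phi>\<^sub>0. \<forall>\<Psi>\<in>admissible Q \<Phi>\<^sub>0. action Q \<Phi> \<le> action Q \<Psi>"
proof -
  have cQ: "continuous_on UNIV (\<lambda>x. Q (to_torus x))" by (rule torus_real_analytic_continuous[OF assms(1)])
  have Q0: "0 \<le> Q \<theta>" for \<theta> using assms(2) by blast
  obtain x where x: "to_torus x = \<Phi>\<^sub>0" by (rule to_torus_surj)
  obtain \<zeta> where "Q \<zeta> = 0" using assms(3) by (auto simp: zero_set_def)
  then obtain z where z: "Q (to_torus z) = 0" using to_torus_surj by metis
  let ?A = "admissible Q \<Phi>\<^sub>0"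
  have ne: "?A \<noteq> {}" using admissible_nonempty[OF cQ z, of x] by (simp add: x)
  have nonneg: "0 \<le> action Q \<Psi>" if \<Psi>: "\<Psi> \<in> ?A" for \<Psi>
  proof (rule admissible_imp_path_from[OF \<Psi>[folded x] Q0])
    fix u :: "real \<Rightarrow> real ^ 'n"
    assume a: "action Q \<Psi> = 1/2 * (LINT t|lborel. (norm (u t))\<^sup>2) + (LINT t:{0<..}|lborel. Q (\<Psi> t))"
    show ?thesis unfolding a set_lebesgue_integral_def
      by (intro add_nonneg_nonneg mult_nonneg_nonneg Bochner_Integration.integral_nonneg) (simp_all add: Q0)
  qed
  then have bdd: "bdd_below (action Q ` ?A)" by (intro bdd_belowI[of _ 0]) auto
  define m where "m = (INF \<Psi>\<in>?A. action Q \<Psi>)"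
  have m: "m \<le> action Q \<Psi>" if "\<Psi> \<in> ?A" for \<Psi> unfolding m_def by (rule cINF_lower[OF bdd that])
  have "\<exists>\<Psi>\<in>?A. action Q \<Psi> < m + 1 / real (Suc i)" for i
    using cInf_lessD[of "action Q ` ?A" "m + 1 / real (Suc i)"] ne by (auto simp: m_def)
  then obtain \<Psi> where \<Psi>: "\<And>i. \<Psi> i \<in> ?A" and \<Psi>m: "\<And>i. action Q (\<Psi> i) < m + 1 / real (Suc i)" by metis
  have actlim: "(\<lambda>i. action Q (\<Psi> i)) \<longlonglongrightarrow> m"
  proof (rule tendsto_sandwich)
    show "eventually (\<lambda>i. m \<le> action Q (\<Psi> i)) sequentially" using m \<Psi> by simp
    show "eventually (\<lambda>i. action Q (\<Psi> i) \<le> m + 1 / real (Suc i)) sequentially" using less_imp_le[OF \<Psi>m] by simp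
    show "(\<lambda>i. m + 1 / real (Suc i)) \<longlonglongrightarrow> m"
      using tendsto_add[OF tendsto_const LIMSEQ_Suc[OF lim_1_over_n], of m] by simp
  qed simp
  have "\<exists>u. square_integrable u \<and> (\<forall>t\<ge>0. \<Psi> i t = to_torus (path_from x u t)) \<and>
      set_integrable lborel {0<..} (\<lambda>t. Q (\<Psi> i t)) \<and>
      action Q (\<Psi> i) = 1/2 * (LINT t|lborel. (norm (u t))\<^sup>2) + (LINT t:{0<..}|lborel. Q (\<Psi> i t))" for i
    by (rule admissible_imp_path_from[OF \<Psi>[of i, folded x] Q0]) blast
  then obtain w where w: "\<And>i. square_integrable (w i)"
    and \<Psi>w: "\<And>i t. 0 \<le> t \<Longrightarrow> \<Psi> i t = to_torus (path_from x (w i) t)"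
    and Qi: "\<And>i. set_integrable lborel {0<..} (\<lambda>t. Q (\<Psi> i t))"
    and act: "\<And>i. action Q (\<Psi> i) = 1/2 * (LINT t|lborel. (norm (w i t))\<^sup>2) + (LINT t:{0<..}|lborel. Q (\<Psi> i t))"
    by metis
  define N where "N u = (LINT t|lborel. (norm (u t))\<^sup>2)" for u :: "real \<Rightarrow> real ^ 'n"
  define B where "B i = (LINT t:{0<..}|lborel. Q (\<Psi> i t))" for i
  \<comment> \<open>The chosen actions are at most m + 1 and their potential part is nonnegative,
    which bounds half the squared norm by m + 1.\<close>
  define E where "E = 2 * (m + 1)"
  have N0: "0 \<le> N u" for u unfolding N_def by (rule Bochner_Integration.integral_nonneg) simp
  have B0: "0 \<le> B i" for i unfolding B_def set_lebesgue_integral_def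
    by (rule Bochner_Integration.integral_nonneg) (simp add: Q0)
  have NE: "N (w i) \<le> E" for i
  proof -
    have "1 / real (Suc i) \<le> 1" by simp
    then have "action Q (\<Psi> i) \<le> m + 1" using \<Psi>m[of i] by linarith
    then show ?thesis using act[of i] B0[of i] by (simp add: E_def N_def B_def)
  qed
  have E0: "0 \<le> E" using N0 NE order_trans by blast
  define p where "p u t = path_from 0 u t" for u :: "real \<Rightarrow> real ^ 'n" and t
  have p_diff: "norm (p u b - p u a) \<le> sqrt ((b - a) * E)" if "square_integrable u" "N u \<le> E" "0 \<le> a" "a \<le> b" for u a b
  proof (rule real_le_rsqrt)
    have "(norm (p u b - p u a))\<^sup>2 \<le> (b - a) * N u"
      using path_from_diff_le[OF that(1,3,4)] by (simp add: p_def N_def)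
    also have "\<dots> \<le> (b - a) * E" using that by (intro mult_left_mono) auto
    finally show "(norm (p u b - p u a))\<^sup>2 \<le> (b - a) * E" .
  qed
  let ?S = "\<rat> \<inter> {0..} :: real set"
  \<comment> \<open>The diagonal subsequence argument wants one bound for all times, hence the
    rescaling by the Hoelder bound at time t; the added 1 avoids division by zero at t = 0.\<close>
  have "norm ((1 / (1 + sqrt (t * E))) *\<^sub>R p (w i) t) \<le> 1" if "t \<in> ?S" for i t
  proof -
    have "norm (p (w i) t) \<le> sqrt (t * E)"
      using p_diff[OF w NE, of 0 t i] that by (simp add: p_def path_from_0)
    moreover have "0 \<le> sqrt (t * E)" using that E0 by simp
    ultimately have "0 < 1 + sqrt (t * E)" "norm (p (w i) t) \<le> 1 + sqrt (t * E)" by linarith+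
    moreover have "norm ((1 / c) *\<^sub>R y) \<le> 1" if "0 < c" "norm y \<le> c" for c and y :: "real ^ 'n"
      using that by (simp add: divide_le_eq)
    ultimately show ?thesis by blast
  qed
  moreover have "countable ?S" by (simp add: countable_rat)
  ultimately obtain k where k: "strict_mono (k :: nat \<Rightarrow> nat)"
    and conv: "\<And>t. t \<in> ?S \<Longrightarrow> \<exists>l. (\<lambda>i. (1 / (1 + sqrt (t * E))) *\<^sub>R p (w (k i)) t) \<longlonglongrightarrow> l"
    using function_convergent_subsequence[of ?S "\<lambda>i t. (1 / (1 + sqrt (t * E))) *\<^sub>R p (w i) t" 1] by metis
  \<comment> \<open>A further subsequence makes the squared norms converge, as the weak limit and
    the limit of the potential parts both require.\<close>
  have "seq_compact {0..E}" by (intro compact_imp_seq_compact compact_Icc)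
  then obtain A l where A: "A \<in> {0..E}" and l: "strict_mono (l :: nat \<Rightarrow> nat)"
    and Alim: "((\<lambda>i. N (w (k i))) \<circ> l) \<longlonglongrightarrow> A"
    by (rule seq_compactE[of _ "\<lambda>i. N (w (k i))"]) (use N0 NE in auto)
  define r where "r = k \<circ> l"
  have r: "strict_mono r" unfolding r_def using k l by (rule strict_mono_o)
  have "\<exists>y. (\<lambda>i. LINT s:{0..t}|lborel. w (r i) s) \<longlonglongrightarrow> y" if t: "t \<in> ?S" for t
  proof -
    obtain y where "(\<lambda>i. (1 / (1 + sqrt (t * E))) *\<^sub>R p (w (k i)) t) \<longlonglongrightarrow> y" using conv[OF t] by blast
    from LIMSEQ_subseq_LIMSEQ[OF this l]
    have "(\<lambda>i. (1 + sqrt (t * E)) *\<^sub>R (1 / (1 + sqrt (t * E))) *\<^sub>R p (w (r i)) t) \<longlonglongrightarrow> (1 + sqrt (t * E)) *\<^sub>R y"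
      unfolding comp_def r_def by (intro tendsto_intros)
    moreover have "0 \<le> sqrt (t * E)" using t E0 by simp
    then have "1 + sqrt (t * E) \<noteq> 0" by linarith
    ultimately show ?thesis by (auto simp: p_def path_from_def)
  qed
  then obtain \<phi> where \<phi>: "\<And>t. t \<in> ?S \<Longrightarrow> (\<lambda>i. LINT s:{0..t}|lborel. w (r i) s) \<longlonglongrightarrow> \<phi> t" by metis
  have rA: "(\<lambda>i. N (w (r i))) \<longlonglongrightarrow> A" using Alim by (simp add: r_def comp_def)
  obtain v where v: "square_integrable v" and vA: "N v \<le> A"
    and v\<phi>: "\<And>t. t \<in> ?S \<Longrightarrow> (LINT s:{0..t}|lborel. v s) = \<phi> t"
    using square_integrable_weak_limit[of "\<lambda>i. w (r i)" ?S \<phi> A] w \<phi> rA unfolding N_def by blast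
  have vE: "N v \<le> E" using vA A by simp
  have plim: "(\<lambda>i. p (w (r i)) t) \<longlonglongrightarrow> p v t" if t: "0 \<le> t" for t
  proof (rule LIMSEQ_I)
    fix e :: real assume e: "e > 0"
    \<comment> \<open>Over a time shorter than \<delta> the Hoelder bound is at most e/3; E + 1
      replaces E to exclude a zero denominator. The rational q is taken to the right of t, so it is
      nonnegative and belongs to the set of times where convergence is known.\<close>
    define \<delta> where "\<delta> = (e / 3)\<^sup>2 / (E + 1)"
    have "\<delta> > 0" using e E0 by (simp add: \<delta>_def)
    then obtain q where q: "q \<in> \<rat>" "t < q" "q < t + \<delta>" using Rats_dense_in_real[of t "t + \<delta>"] by auto
    have qS: "q \<in> ?S" using q t by simp
    have "(q - t) * E \<le> \<delta> * (E + 1)" using q E0 by (intro mult_mono) auto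
    also have "\<dots> = (e / 3)\<^sup>2" using E0 by (simp add: \<delta>_def)
    finally have sq: "sqrt ((q - t) * E) \<le> e / 3" using e by (intro real_le_lsqrt) auto
    obtain M where M: "\<And>i. i \<ge> M \<Longrightarrow> norm (p (w (r i)) q - p v q) < e / 3"
      using LIMSEQ_D[OF \<phi>[OF qS], of "e / 3"] e v\<phi>[OF qS] by (auto simp: p_def path_from_def)
    have "norm (p (w (r i)) t - p v t) < e" if "i \<ge> M" for i
    proof -
      have "norm (p (w (r i)) q - p (w (r i)) t) \<le> e / 3" "norm (p v q - p v t) \<le> e / 3"
        using p_diff[OF w NE t, of q "r i"] p_diff[OF v vE t, of q] q sq by linarith+
      moreover have "p (w (r i)) t - p v t = (p (w (r i)) q - p v q) - (p (w (r i)) q - p (w (r i)) t) + (p v q - p v t)" by simp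
      moreover have "norm (X - Y + Z) < e" if "norm X < e / 3" "norm Y \<le> e / 3" "norm Z \<le> e / 3" for X Y Z :: "real ^ 'n"
        using norm_triangle_ineq[of "X - Y" Z] norm_triangle_ineq4[of X Y] that by linarith
      ultimately show ?thesis using M[OF that] by metis
    qed
    then show "\<exists>M. \<forall>i\<ge>M. norm (p (w (r i)) t - p v t) < e" by blast
  qed
  define \<Phi> where "\<Phi> t = to_torus (path_from x v t)" for t
  have Qlim: "(\<lambda>i. Q (\<Psi> (r i) t)) \<longlonglongrightarrow> Q (\<Phi> t)" if t: "0 \<le> t" for t
  proof -
    have "(\<lambda>i. x + p (w (r i)) t) \<longlonglongrightarrow> x + p v t" by (intro tendsto_intros plim t)
    then have "(\<lambda>i. path_from x (w (r i)) t) \<longlonglongrightarrow> path_from x v t" by (simp add: p_def flip: path_from_add)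
    then have "(\<lambda>i. Q (to_torus (path_from x (w (r i)) t))) \<longlonglongrightarrow> Q (to_torus (path_from x v t))"
      by (rule continuous_on_tendsto_compose[OF cQ]) auto
    then show ?thesis using t by (simp add: \<Psi>w \<Phi>_def)
  qed
  have Blim: "(\<lambda>i. B (r i)) \<longlonglongrightarrow> m - 1/2 * A"
  proof -
    have "(\<lambda>i. action Q (\<Psi> (r i)) - 1/2 * N (w (r i))) \<longlonglongrightarrow> m - 1/2 * A"
      using LIMSEQ_subseq_LIMSEQ[OF actlim r] by (intro tendsto_intros rA) (simp add: comp_def)
    then show ?thesis by (simp add: act N_def B_def)
  qed
  have J: "open {0::real<..}" "is_interval {0::real<..}" by (auto simp: is_interval_1)
  have "continuous_on {0<..} (path_from x v)"
    by (rule primitive_on_continuous[OF J primitive_on_subset[OF path_from_primitive[OF v]]]) auto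
  then have "continuous_on {0<..} (\<lambda>t. Q (\<Phi> t))"
    unfolding \<Phi>_def by (rule continuous_on_compose2[OF cQ]) auto
  then have meas: "(\<lambda>t. indicator {0<..} t *\<^sub>R Q (\<Phi> t)) \<in> borel_measurable lborel"
    using borel_measurable_continuous_on_indicator[of "{0<..}" "\<lambda>t. Q (\<Phi> t)"] by simp
  have AE: "AE t in lborel. (\<lambda>i. indicator {0<..} t *\<^sub>R Q (\<Psi> (r i) t)) \<longlonglongrightarrow> indicator {0<..} t *\<^sub>R Q (\<Phi> t)"
    using Qlim by (intro AE_I2) (auto simp: indicator_def)
  have F: "integrable lborel (\<lambda>t. indicator {0<..} t *\<^sub>R Q (\<Phi> t))"
    "(LINT t|lborel. indicator {0<..} t *\<^sub>R Q (\<Phi> t)) \<le> m - 1/2 * A"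
    using Fatou_real[OF Qi[of "r _", unfolded set_integrable_def] _ meas AE _ Blim] Q0
    by (simp_all add: B_def set_lebesgue_integral_def)
  have Q\<Phi>: "set_integrable lborel {0<..} (\<lambda>t. Q (\<Phi> t))" using F(1) by (simp add: set_integrable_def)
  note adm = path_from_admissible[OF v \<Phi>_def Q\<Phi>]
  have v2: "integrable lborel (\<lambda>t. (norm (v t))\<^sup>2)" using v by (simp add: square_integrable_def)
  \<comment> \<open>Nonzero values of v at negative times would only enlarge \<open>N v\<close>. The
    kinetic part is thus at most A/2 and the potential part at most m - A/2.\<close>
  have "(LINT t:{0<..}|lborel. (norm (v t))\<^sup>2) \<le> N v"
    unfolding N_def set_lebesgue_integral_def
    by (intro integral_mono integrable_mult_indicator v2) (auto simp: indicator_def)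
  then have "action Q \<Phi> \<le> m" using adm(2) F(2) vA by (simp add: set_lebesgue_integral_def)
  then show ?thesis using adm(1) m x by (metis order_trans)
qed

end
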